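(* Let $\Theta(\lambda)$ belong to the Schur class $\mathbf S(\mathfrak M,\mathfrak N)$. If the system $\tau=\left\{\begin{pmatrix}A&B\\ C&D\end{pmatrix};\mathfrak H,\mathfrak M,\mathfrak N\right\}$ is a passive minimal and optimal realization of $\Theta(\lambda)$, then $$(D_T^2)_{\mathfrak H}=0,\qquad T=\begin{pmatrix}A&B\\ C&D\end{pmatrix}.$$
   Context: Hilbert spaces are complex and separable. $\mathbf S(\mathfrak M,\mathfrak N)$ is the class of holomorphic functions on the open unit disk $\mathbb D$ with contractive values in the bounded operators from $\mathfrak M$ to $\mathfrak N$. A passive system is given by a contraction $T=\begin{pmatrix}A&B\\C&D\end{pmatrix}:\mathfrak H\oplus\mathfrak M\to\mathfrak H\oplus\mathfrak N$; it realizes its transfer function $D+\lambda C(I_{\mathfrak H}-\lambda A)^{-1}B$. It is minimal if $\overline{\mathrm{span}}\{A^nB\mathfrak M:n\ge0\}=\mathfrak H$ and $\overline{\mathrm{span}}\{A^{*n}C^*\mathfrak N:n\ge0\}=\mathfrak H$. A passive realization $\dot\tau=\left\{\begin{pmatrix}\dot A&\dot B\\ \dot C&D\end{pmatrix};\dot{\mathfrak H},\mathfrak M,\mathfrak N\right\}$ of $\Theta$ is optimal if for each passive system $\left\{\begin{pmatrix}A&B\\C&D\end{pmatrix};\mathfrak H,\mathfrak M,\mathfrak N\right\}$ with transfer function $\Theta$ and each sequence $u_0,u_1,\ldots$ in $\mathfrak M$ one has $\left\|\sum_{k=0}^n\dot A^k\dot Bu_k\right\|_{\dot{\mathfrak H}}\le\left\|\sum_{k=0}^nA^kBu_k\right\|_{\mathfrak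 H}$ for all $n=0,1,\ldots$. $D_T=(I-T^*T)^{1/2}$. Shorted operator: for bounded $S\ge0$ in $\mathcal H$ and a closed subspace $\mathcal K$, $S_{\mathcal K}=\max\{Z:\ 0\le Z\le S,\ \mathrm{ran}\,Z\subseteq\mathcal K\}$. *)

theory Defs
  imports "HOL-Analysis.Analysis"
begin

section \<open>Complex Hilbert spaces\<close>

text \<open>
  Complex inner products are linear in the first argument. The class extends \<^class>\<open>real_inner\<close>,
  whose inner product is the real part of the complex one, so that norm, topology and
  convergence are those of the library.
\<close>

class complex_inner = real_inner +
  fixes scaleC :: "complex \<Rightarrow> 'a \<Rightarrow> 'a"  (infixr "*\<^sub>C" 75)
    and cinner :: "'a \<Rightarrow> 'a \<Rightarrow> complex"
  assumes scaleC_add_right: "a *\<^sub>C (x + y) = a *\<^sub>C x + a *\<^sub>C y"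
    and scaleC_add_left: "(a + b) *\<^sub>C x = a *\<^sub>C x + b *\<^sub>C x"
    and scaleC_scaleC: "a *\<^sub>C b *\<^sub>C x = (a * b) *\<^sub>C x"
    and scaleC_of_real: "complex_of_real r *\<^sub>C x = r *\<^sub>R x"
    and cinner_commute: "cinner x y = cnj (cinner y x)"
    and cinner_add_left: "cinner (x + y) z = cinner x z + cinner y z"
    and cinner_scaleC_left: "cinner (a *\<^sub>C x) y = a * cinner x y"
    and Re_cinner: "Re (cinner x y) = inner x y"

class separable_hilbert_space = complex_inner + complete_space + second_countable_topology

lemma scaleC_one: "1 *\<^sub>C x = (x :: 'a::complex_inner)"
  using scaleC_of_real[of 1 x] by simp

global_interpretation complex_vector: vector_space "scaleC :: complex \<Rightarrow> 'a \<Rightarrow> 'a::complex_inner"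
  defines csubspace = complex_vector.subspace
    and cspan = complex_vector.span
  by unfold_locales (auto simp: scaleC_add_right scaleC_add_left scaleC_scaleC scaleC_one)

lemma cinner_self: "cinner x x = complex_of_real ((norm x)\<^sup>2)" for x :: "'a::complex_inner"
proof (rule complex_eqI)
  show "Im (cinner x x) = Im (complex_of_real ((norm x)\<^sup>2))"
    using arg_cong[OF cinner_commute[of x x], of Im] by simp
qed (simp add: Re_cinner power2_norm_eq_inner)

lemma norm_scaleC: "norm (a *\<^sub>C x) = cmod a * norm x" for x :: "'a::complex_inner"
proof -
  have "cinner (a *\<^sub>C x) (a *\<^sub>C x) = a * cnj a * cinner x x"
    by (metis cinner_commute cinner_scaleC_left complex_cnj_mult mult.assoc)
  then have "complex_of_real ((norm (a *\<^sub>C x))\<^sup>2) = complex_of_real ((cmod a * norm x)\<^sup>2)"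
    by (simp add: cinner_self complex_norm_square[symmetric] power_mult_distrib)
  then have "(norm (a *\<^sub>C x))\<^sup>2 = (cmod a * norm x)\<^sup>2"
    using of_real_eq_iff by blast
  then show ?thesis by (simp add: power2_eq_iff_nonneg)
qed

instantiation complex :: complex_inner
begin
definition scaleC_complex :: "complex \<Rightarrow> complex \<Rightarrow> complex" where "scaleC_complex a x = a * x"
definition cinner_complex :: "complex \<Rightarrow> complex \<Rightarrow> complex" where "cinner_complex x y = x * cnj y"
instance
  by standard (auto simp: scaleC_complex_def cinner_complex_def algebra_simps scaleR_conv_of_real
      inner_complex_def)
end

instance complex :: separable_hilbert_space ..

instantiation prod :: (complex_inner, complex_inner) complex_inner
begin
definition scaleC_prod :: "complex \<Rightarrow> 'a \<times> 'b \<Rightarrow> 'a \<times> 'b" where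
  "scaleC_prod a x = (a *\<^sub>C fst x, a *\<^sub>C snd x)"
definition cinner_prod :: "'a \<times> 'b \<Rightarrow> 'a \<times> 'b \<Rightarrow> complex" where
  "cinner_prod x y = cinner (fst x) (fst y) + cinner (snd x) (snd y)"
instance
proof
  fix x y :: "'a \<times> 'b"
  show "cinner x y = cnj (cinner y x)"
    unfolding cinner_prod_def by (metis cinner_commute complex_cnj_add)
qed (auto simp: scaleC_prod_def cinner_prod_def scaleC_add_right scaleC_add_left scaleC_scaleC
      scaleC_of_real cinner_add_left cinner_scaleC_left Re_cinner algebra_simps inner_prod_def
      prod_eq_iff)
end

instance prod :: (separable_hilbert_space, separable_hilbert_space) separable_hilbert_space
  ..

section \<open>The Hilbert space of square-summable sequences\<close>

typedef ell2 = "{f :: nat \<Rightarrow> complex. summable (\<lambda>n. (cmod (f n))\<^sup>2)}"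
  morphisms ell2_nth Abs_ell2
  by (rule exI[of _ "\<lambda>_. 0"]) simp

setup_lifting type_definition_ell2

lemma ell2_summable: "summable (\<lambda>n. (cmod (ell2_nth f n))\<^sup>2)"
  using ell2_nth[of f] by simp

lemma ell2_summable_add:
  assumes "summable (\<lambda>n. (cmod (f n))\<^sup>2)" "summable (\<lambda>n. (cmod (g n))\<^sup>2)"
  shows "summable (\<lambda>n. (cmod (f n + g n))\<^sup>2)"
proof (rule summable_comparison_test')
  show "summable (\<lambda>n. 2 * (cmod (f n))\<^sup>2 + 2 * (cmod (g n))\<^sup>2)"
    using assms by (intro summable_add summable_mult)
  fix n
  have "(cmod (f n + g n))\<^sup>2 \<le> (cmod (f n) + cmod (g n))\<^sup>2"
    by (intro power_mono norm_triangle_ineq) auto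
  also have "\<dots> \<le> 2 * (cmod (f n))\<^sup>2 + 2 * (cmod (g n))\<^sup>2"
    using sum_squares_bound[of "cmod (f n)" "cmod (g n)"] by (simp add: power2_sum)
  finally show "norm ((cmod (f n + g n))\<^sup>2) \<le> 2 * (cmod (f n))\<^sup>2 + 2 * (cmod (g n))\<^sup>2"
    by simp
qed

lemma ell2_summable_mult:
  assumes "summable (\<lambda>n. (cmod (f n))\<^sup>2)" "summable (\<lambda>n. (cmod (g n))\<^sup>2)"
  shows "summable (\<lambda>n. f n * cnj (g n))"
proof (rule summable_comparison_test')
  show "summable (\<lambda>n. (cmod (f n))\<^sup>2 + (cmod (g n))\<^sup>2)"
    using assms by (intro summable_add)
  fix n
  show "norm (f n * cnj (g n)) \<le> (cmod (f n))\<^sup>2 + (cmod (g n))\<^sup>2"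
    using sum_squares_bound[of "cmod (f n)" "cmod (g n)"]
      mult_nonneg_nonneg[OF norm_ge_zero[of "f n"] norm_ge_zero[of "g n"]]
    unfolding norm_mult complex_mod_cnj by linarith
qed

instantiation ell2 :: complex_inner
begin

lift_definition zero_ell2 :: ell2 is "\<lambda>_. 0" by simp
lift_definition plus_ell2 :: "ell2 \<Rightarrow> ell2 \<Rightarrow> ell2" is "\<lambda>f g n. f n + g n"
  by (rule ell2_summable_add)
lift_definition uminus_ell2 :: "ell2 \<Rightarrow> ell2" is "\<lambda>f n. - f n" by simp
lift_definition minus_ell2 :: "ell2 \<Rightarrow> ell2 \<Rightarrow> ell2" is "\<lambda>f g n. f n - g n"
  using ell2_summable_add[of _ "\<lambda>n. - _ n"] by simp
lift_definition scaleC_ell2 :: "complex \<Rightarrow> ell2 \<Rightarrow> ell2" is "\<lambda>a f n. a * f n"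
  by (simp add: norm_mult power_mult_distrib summable_mult)
definition scaleR_ell2 :: "real \<Rightarrow> ell2 \<Rightarrow> ell2" where "scaleR_ell2 r x = complex_of_real r *\<^sub>C x"
definition cinner_ell2 :: "ell2 \<Rightarrow> ell2 \<Rightarrow> complex" where
  "cinner_ell2 f g = (\<Sum>n. ell2_nth f n * cnj (ell2_nth g n))"
definition inner_ell2 :: "ell2 \<Rightarrow> ell2 \<Rightarrow> real" where "inner_ell2 f g = Re (cinner f g)"
definition norm_ell2 :: "ell2 \<Rightarrow> real" where "norm_ell2 f = sqrt (inner f f)"
definition dist_ell2 :: "ell2 \<Rightarrow> ell2 \<Rightarrow> real" where "dist_ell2 f g = norm (f - g)"
definition sgn_ell2 :: "ell2 \<Rightarrow> ell2" where "sgn_ell2 f = inverse (norm f) *\<^sub>R f"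
definition uniformity_ell2 :: "(ell2 \<times> ell2) filter" where
  "uniformity_ell2 = (INF e\<in>{0<..}. principal {(x, y). dist x y < e})"
definition open_ell2 :: "ell2 set \<Rightarrow> bool" where
  "open_ell2 S \<longleftrightarrow> (\<forall>x\<in>S. \<forall>\<^sub>F (x', y) in uniformity. x' = x \<longrightarrow> y \<in> S)"

lemma ell2_inner_self: "inner f f = (\<Sum>n. (cmod (ell2_nth f n))\<^sup>2)" for f :: ell2
proof -
  have "cinner f f = (\<Sum>n. complex_of_real ((cmod (ell2_nth f n))\<^sup>2))"
    unfolding cinner_ell2_def complex_norm_square[symmetric] by (rule refl)
  then show ?thesis
    by (simp only: inner_ell2_def suminf_of_real[OF ell2_summable, symmetric] Re_complex_of_real)
qed

instance
proof
  fix x y z :: ell2 and a b :: complex and r s :: real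
  have sm: "summable (\<lambda>n. ell2_nth f n * cnj (ell2_nth g n))" for f g
    by (rule ell2_summable_mult; rule ell2_summable)
  have add: "cinner (x + y) z = cinner x z + cinner y z" for x y z :: ell2
    unfolding cinner_ell2_def
    by (subst suminf_add[OF sm sm]) (simp add: plus_ell2.rep_eq algebra_simps)
  have scl: "cinner (a *\<^sub>C x) y = a * cinner x y" for a and x y :: ell2
    unfolding cinner_ell2_def
    by (subst suminf_mult[OF sm, symmetric]) (simp add: scaleC_ell2.rep_eq algebra_simps)
  have com: "cinner x y = cnj (cinner y x)" for x y :: ell2
    unfolding cinner_ell2_def using sums_cnj[THEN iffD2, OF summable_sums[OF sm[of y x]]]
    by (simp add: sums_iff mult.commute)
  show "x + y + z = x + (y + z)" "x + y = y + x" "0 + x = x" "- x + x = 0" "x - y = x + - y"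
    by (transfer, auto simp: add_ac)+
  show "r *\<^sub>R (x + y) = r *\<^sub>R x + r *\<^sub>R y" "(r + s) *\<^sub>R x = r *\<^sub>R x + s *\<^sub>R x"
    "r *\<^sub>R s *\<^sub>R x = (r * s) *\<^sub>R x" "1 *\<^sub>R x = x"
    unfolding scaleR_ell2_def by (transfer, auto simp: algebra_simps)+
  show "a *\<^sub>C (x + y) = a *\<^sub>C x + a *\<^sub>C y" "(a + b) *\<^sub>C x = a *\<^sub>C x + b *\<^sub>C x"
    "a *\<^sub>C b *\<^sub>C x = (a * b) *\<^sub>C x"
    by (transfer, auto simp: algebra_simps)+
  show "sgn x = inverse (norm x) *\<^sub>R x" by (rule sgn_ell2_def)
  show "dist x y = norm (x - y)" by (rule dist_ell2_def)
  show "uniformity = (INF e\<in>{0<..}. principal {(x, y :: ell2). dist x y < e})"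
    by (rule uniformity_ell2_def)
  show "open U \<longleftrightarrow> (\<forall>x\<in>U. \<forall>\<^sub>F (x', y) in uniformity. x' = x \<longrightarrow> y \<in> U)" for U :: "ell2 set"
    by (rule open_ell2_def)
  show "inner x y = inner y x" unfolding inner_ell2_def by (subst com) simp
  show "inner (x + y) z = inner x z + inner y z" by (simp add: inner_ell2_def add)
  show "inner (r *\<^sub>R x) y = r * inner x y" by (simp add: inner_ell2_def scaleR_ell2_def scl)
  show "0 \<le> inner x x"
    by (simp add: ell2_inner_self suminf_nonneg[OF ell2_summable])
  show "(inner x x = 0) = (x = 0)"
    unfolding ell2_inner_self suminf_eq_zero_iff[OF ell2_summable zero_le_power2]
    by (metis (no_types) ell2_nth_inject ext norm_eq_zero power_eq_0_iff zero_ell2.rep_eq zero_power2)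
  show "norm x = sqrt (inner x x)" by (rule norm_ell2_def)
  show "complex_of_real r *\<^sub>C x = r *\<^sub>R x" by (simp add: scaleR_ell2_def)
  show "cinner x y = cnj (cinner y x)" by (rule com)
  show "cinner (x + y) z = cinner x z + cinner y z" by (rule add)
  show "cinner (a *\<^sub>C x) y = a * cinner x y" by (rule scl)
  show "Re (cinner x y) = inner x y" by (simp add: inner_ell2_def)
qed

end

lemma ell2_norm_squared: "(norm f)\<^sup>2 = (\<Sum>n. (cmod (ell2_nth f n))\<^sup>2)"
  by (simp add: power2_norm_eq_inner ell2_inner_self)

lemma ell2_nth_le_norm: "cmod (ell2_nth f n) \<le> norm f"
proof (rule power2_le_imp_le)
  show "(cmod (ell2_nth f n))\<^sup>2 \<le> (norm f)\<^sup>2"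
    using sum_le_suminf[OF ell2_summable, of "{n}" f] by (simp add: ell2_norm_squared)
qed (rule norm_ge_zero)

lemma ell2_normI:
  assumes "\<And>N. (\<Sum>n<N. (cmod (f n))\<^sup>2) \<le> e\<^sup>2" "e \<ge> 0"
  shows "summable (\<lambda>n. (cmod (f n))\<^sup>2)" "norm (Abs_ell2 f) \<le> e"
proof -
  show s: "summable (\<lambda>n. (cmod (f n))\<^sup>2)"
    by (rule summableI_nonneg_bounded[OF zero_le_power2 assms(1)])
  then have "ell2_nth (Abs_ell2 f) = f" by (intro Abs_ell2_inverse) simp
  then have "(norm (Abs_ell2 f))\<^sup>2 \<le> e\<^sup>2"
    using suminf_le_const[OF s assms(1)] by (simp only: ell2_norm_squared)
  then show "norm (Abs_ell2 f) \<le> e" using assms(2) by (rule power2_le_imp_le)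
qed

instance ell2 :: complete_space
proof
  fix X :: "nat \<Rightarrow> ell2"
  assume X: "Cauchy X"
  have "Cauchy (\<lambda>i. ell2_nth (X i) n)" for n
  proof (rule metric_CauchyI)
    fix e :: real assume "e > 0"
    then obtain M where "\<forall>i\<ge>M. \<forall>j\<ge>M. dist (X i) (X j) < e"
      using metric_CauchyD[OF X] by blast
    moreover have "dist (ell2_nth (X i) n) (ell2_nth (X j) n) \<le> dist (X i) (X j)" for i j
      using ell2_nth_le_norm[of "X i - X j" n] by (simp add: dist_norm minus_ell2.rep_eq)
    ultimately show "\<exists>M. \<forall>i\<ge>M. \<forall>j\<ge>M. dist (ell2_nth (X i) n) (ell2_nth (X j) n) < e"
      by (meson le_less_trans)
  qed
  then have "\<forall>n. \<exists>l. (\<lambda>i. ell2_nth (X i) n) \<longlonglongrightarrow> l"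
    by (simp add: Cauchy_convergent_iff convergent_def)
  then obtain x where x: "\<And>n. (\<lambda>i. ell2_nth (X i) n) \<longlonglongrightarrow> x n" by metis
  have bound: "\<exists>M. \<forall>i\<ge>M. \<forall>N. (\<Sum>n<N. (cmod (ell2_nth (X i) n - x n))\<^sup>2) \<le> e\<^sup>2" if e: "e > 0" for e
  proof -
    obtain M where M: "\<forall>i\<ge>M. \<forall>j\<ge>M. dist (X i) (X j) < e"
      using metric_CauchyD[OF X e] by blast
    have "(\<Sum>n<N. (cmod (ell2_nth (X i) n - x n))\<^sup>2) \<le> e\<^sup>2" if "i \<ge> M" for i N
    proof (rule tendsto_upperbound)
      show "(\<lambda>j. \<Sum>n<N. (cmod (ell2_nth (X i) n - ell2_nth (X j) n))\<^sup>2)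
          \<longlonglongrightarrow> (\<Sum>n<N. (cmod (ell2_nth (X i) n - x n))\<^sup>2)"
        by (intro tendsto_intros x)
      have "(\<Sum>n<N. (cmod (ell2_nth (X i) n - ell2_nth (X j) n))\<^sup>2) \<le> e\<^sup>2" if "j \<ge> M" for j
      proof -
        have "(\<Sum>n<N. (cmod (ell2_nth (X i - X j) n))\<^sup>2) \<le> (norm (X i - X j))\<^sup>2"
          unfolding ell2_norm_squared by (rule sum_le_suminf[OF ell2_summable]) auto
        also have "\<dots> \<le> e\<^sup>2"
          using M \<open>i \<ge> M\<close> that by (intro power_mono) (auto simp: dist_norm less_imp_le)
        finally show ?thesis by (simp add: minus_ell2.rep_eq)
      qed
      then show "\<forall>\<^sub>F j in sequentially.
          (\<Sum>n<N. (cmod (ell2_nth (X i) n - ell2_nth (X j) n))\<^sup>2) \<le> e\<^sup>2"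
        by (rule eventually_sequentiallyI)
    qed simp
    then show ?thesis by blast
  qed
  obtain M where M: "\<And>N. (\<Sum>n<N. (cmod (ell2_nth (X M) n - x n))\<^sup>2) \<le> 1\<^sup>2"
    using bound[of 1] by auto
  have "summable (\<lambda>n. (cmod (ell2_nth (X M) n + - (ell2_nth (X M) n - x n)))\<^sup>2)"
  proof (rule ell2_summable_add[OF ell2_summable])
    show "summable (\<lambda>n. (cmod (- (ell2_nth (X M) n - x n)))\<^sup>2)"
      unfolding norm_minus_cancel by (rule ell2_normI(1)[OF M]) simp
  qed
  then have sx: "summable (\<lambda>n. (cmod (x n))\<^sup>2)" by simp
  have "X \<longlonglongrightarrow> Abs_ell2 x"
  proof (rule metric_LIMSEQ_I)
    fix e :: real assume e: "e > 0"
    then obtain M where M: "\<And>i N. i \<ge> M \<Longrightarrow> (\<Sum>n<N. (cmod (ell2_nth (X i) n - x n))\<^sup>2) \<le> (e/2)\<^sup>2"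
      using bound[of "e/2"] by auto
    have "dist (X i) (Abs_ell2 x) < e" if "i \<ge> M" for i
    proof -
      have "X i - Abs_ell2 x = Abs_ell2 (\<lambda>n. ell2_nth (X i) n - x n)"
        using sx by (simp add: minus_ell2_def Abs_ell2_inverse)
      then have "norm (X i - Abs_ell2 x) \<le> e/2"
        using ell2_normI(2)[OF M[OF that]] e by simp
      then show ?thesis using e by (simp add: dist_norm)
    qed
    then show "\<exists>M. \<forall>i\<ge>M. dist (X i) (Abs_ell2 x) < e" by blast
  qed
  then show "convergent X" by (auto simp: convergent_def)
qed

section \<open>Passive systems\<close>

definition clinear_on ::
  "'a::complex_inner set \<Rightarrow> 'b::complex_inner set \<Rightarrow> ('a \<Rightarrow> 'b) \<Rightarrow> bool" where
  "clinear_on X Y f \<longleftrightarrow> f ` X \<subseteq> Y \<and> (\<forall>x\<in>X. \<forall>y\<in>X. f (x + y) = f x + f y) \<and>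
     (\<forall>c. \<forall>x\<in>X. f (c *\<^sub>C x) = c *\<^sub>C f x)"

definition block_op ::
  "('h \<Rightarrow> 'h) \<Rightarrow> ('m \<Rightarrow> 'h) \<Rightarrow> ('h \<Rightarrow> 'n) \<Rightarrow> ('m \<Rightarrow> 'n) \<Rightarrow> 'h \<times> 'm \<Rightarrow> 'h::plus \<times> 'n::plus" where
  "block_op A B C D = (\<lambda>(h, u). (A h + B u, C h + D u))"

text \<open>
  The state space is a closed subspace \<open>H\<close> of a Hilbert space type, with \<open>H = UNIV\<close> when the
  state space is that type. Values of \<open>A\<close> and \<open>C\<close> outside \<open>H\<close> are irrelevant.
\<close>

definition passive_system ::
  "'h::complex_inner set \<Rightarrow> ('h \<Rightarrow> 'h) \<Rightarrow> ('m::complex_inner \<Rightarrow> 'h) \<Rightarrow> ('h \<Rightarrow> 'n::complex_inner) \<Rightarrow>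
     ('m \<Rightarrow> 'n) \<Rightarrow> bool" where
  "passive_system H A B C D \<longleftrightarrow> closed H \<and> csubspace H \<and>
     clinear_on H H A \<and> clinear_on UNIV H B \<and> clinear_on H UNIV C \<and> clinear_on UNIV UNIV D \<and>
     (\<forall>h\<in>H. \<forall>u. norm (block_op A B C D (h, u)) \<le> norm (h, u))"

definition transfer_function ::
  "'h::complex_inner set \<Rightarrow> ('h \<Rightarrow> 'h) \<Rightarrow> ('m \<Rightarrow> 'h) \<Rightarrow> ('h \<Rightarrow> 'n::complex_inner) \<Rightarrow>
     ('m \<Rightarrow> 'n) \<Rightarrow> complex \<Rightarrow> 'm \<Rightarrow> 'n" where
  "transfer_function H A B C D z u = D u + z *\<^sub>C C (inv_into H (\<lambda>h. h - z *\<^sub>C A h) (B u))"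

definition realizes ::
  "'h::complex_inner set \<Rightarrow> ('h \<Rightarrow> 'h) \<Rightarrow> ('m \<Rightarrow> 'h) \<Rightarrow> ('h \<Rightarrow> 'n::complex_inner) \<Rightarrow>
     ('m \<Rightarrow> 'n) \<Rightarrow> (complex \<Rightarrow> 'm \<Rightarrow> 'n) \<Rightarrow> bool" where
  "realizes H A B C D \<Theta> \<longleftrightarrow> (\<forall>z\<in>ball 0 1. transfer_function H A B C D z = \<Theta> z)"

text \<open>Holomorphy is complex differentiability with respect to the operator norm.\<close>

definition schur_class :: "(complex \<Rightarrow> 'm::complex_inner \<Rightarrow> 'n::complex_inner) \<Rightarrow> bool" where
  "schur_class \<Theta> \<longleftrightarrow>
     (\<forall>z\<in>ball 0 1. clinear_on UNIV UNIV (\<Theta> z) \<and> (\<forall>u. norm (\<Theta> z u) \<le> norm u)) \<and>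
     (\<forall>z\<in>ball 0 1. \<exists>\<Theta>'. clinear_on UNIV UNIV \<Theta>' \<and> bounded_linear \<Theta>' \<and>
       ((\<lambda>w. onorm (\<lambda>u. inverse (w - z) *\<^sub>C (\<Theta> w u - \<Theta> z u) - \<Theta>' u)) \<longlongrightarrow> 0) (at z))"

definition cadjoint :: "('a::complex_inner \<Rightarrow> 'b::complex_inner) \<Rightarrow> 'b \<Rightarrow> 'a" where
  "cadjoint f = (SOME f'. \<forall>x y. cinner (f x) y = cinner x (f' y))"

definition minimal_system ::
  "('h::complex_inner \<Rightarrow> 'h) \<Rightarrow> ('m \<Rightarrow> 'h) \<Rightarrow> ('h \<Rightarrow> 'n::complex_inner) \<Rightarrow> bool" where
  "minimal_system A B C \<longleftrightarrow>
     closure (cspan (\<Union>n. range (A ^^ n \<circ> B))) = UNIV \<and>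
     closure (cspan (\<Union>n. range (cadjoint A ^^ n \<circ> cadjoint C))) = UNIV"

text \<open>
  Types cannot be quantified inside a definition, so the competing state spaces range over the
  closed subspaces of \<^typ>\<open>ell2\<close>. Up to unitary equivalence these are all the separable Hilbert
  spaces; see \<open>optimal_systemD\<close> below for competitors on an arbitrary type.
\<close>

definition optimal_system ::
  "(complex \<Rightarrow> 'm::complex_inner \<Rightarrow> 'n::complex_inner) \<Rightarrow> ('h::complex_inner \<Rightarrow> 'h) \<Rightarrow> ('m \<Rightarrow> 'h) \<Rightarrow> bool"
  where
  "optimal_system \<Theta> A B \<longleftrightarrow>
     (\<forall>(H :: ell2 set) A' B' C' D'. passive_system H A' B' C' D' \<longrightarrow> realizes H A' B' C' D' \<Theta> \<longrightarrow>
       (\<forall>(u :: nat \<Rightarrow> 'm) n. norm (\<Sum>k\<le>n. (A ^^ k) (B (u k))) \<le> norm (\<Sum>k\<le>n. (A' ^^ k) (B' (u k)))))"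

section \<open>Defect operators and shorted operators\<close>

definition nonneg_op :: "('a::complex_inner \<Rightarrow> 'a) \<Rightarrow> bool" where
  "nonneg_op S \<longleftrightarrow> bounded_linear S \<and> clinear_on UNIV UNIV S \<and> (\<forall>x. cinner (S x) x \<in> \<real>\<^sub>\<ge>\<^sub>0)"

definition op_le :: "('a::complex_inner \<Rightarrow> 'a) \<Rightarrow> ('a \<Rightarrow> 'a) \<Rightarrow> bool" where
  "op_le Z S \<longleftrightarrow> nonneg_op (\<lambda>x. S x - Z x)"

text \<open>
  As with \<^const>\<open>adjoint\<close> in the library, choice picks an operator that exists and is unique for
  bounded operators on Hilbert spaces (the adjoint above, the nonnegative square root here).
\<close>

definition sqrt_op :: "('a::complex_inner \<Rightarrow> 'a) \<Rightarrow> 'a \<Rightarrow> 'a" where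
  "sqrt_op S = (SOME R. nonneg_op R \<and> R \<circ> R = S)"

definition defect_op :: "('a::complex_inner \<Rightarrow> 'b::complex_inner) \<Rightarrow> 'a \<Rightarrow> 'a" where
  "defect_op T = sqrt_op (\<lambda>x. x - cadjoint T (T x))"

definition shorted_op :: "('a::complex_inner \<Rightarrow> 'a) \<Rightarrow> 'a set \<Rightarrow> 'a \<Rightarrow> 'a" where
  "shorted_op S K =
     (let \<Z> = {Z. nonneg_op Z \<and> op_le Z S \<and> range Z \<subseteq> K}
      in THE Z. Z \<in> \<Z> \<and> (\<forall>W\<in>\<Z>. op_le W Z))"

section \<open>Separable Hilbert spaces embed isometrically into ell2\<close>

lemma cinner_diff_left: "cinner (x - y) z = cinner x z - cinner y z" for x :: "'a::complex_inner"
  using cinner_add_left[of "x - y" y z] by simp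

lemma cinner_zero_left: "cinner 0 z = 0" for z :: "'a::complex_inner"
  using cinner_diff_left[of z z z] by simp

lemma cinner_sum_left: "cinner (sum f I) z = (\<Sum>i\<in>I. cinner (f i) z)" for z :: "'a::complex_inner"
  by (induction I rule: infinite_finite_induct) (auto simp: cinner_zero_left cinner_add_left)

lemma cinner_scaleR_left: "cinner (r *\<^sub>R x) y = of_real r * cinner x y" for x :: "'a::complex_inner"
  by (metis cinner_scaleC_left scaleC_of_real)

lemma cinner_scaleR_right: "cinner x (r *\<^sub>R y) = of_real r * cinner x y" for x :: "'a::complex_inner"
  using cinner_scaleR_left[of r y x] by (metis cinner_commute complex_cnj_complex_of_real complex_cnj_mult)

text \<open>Vectors that depend linearly on their predecessors yield \<open>0\<close>.\<close>

fun gram_schmidt :: "(nat \<Rightarrow> 'a::complex_inner) \<Rightarrow> nat \<Rightarrow> 'a" where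
  "gram_schmidt d n =
     sgn (d n - (\<Sum>k<n. cinner (d n) (gram_schmidt d k) *\<^sub>C gram_schmidt d k))"

declare gram_schmidt.simps [simp del]

lemma isometry_ell2:
  "\<exists>J :: 'a::separable_hilbert_space \<Rightarrow> ell2. clinear_on UNIV UNIV J \<and> (\<forall>x. norm (J x) = norm x)"
proof -
  obtain D :: "'a set" where D: "countable D" "\<And>X. open X \<Longrightarrow> X \<noteq> {} \<Longrightarrow> \<exists>d\<in>D. d \<in> X"
    by (rule countable_dense_setE) blast
  from D(2)[of UNIV] have "D \<noteq> {}" by auto
  define d where "d = from_nat_into D"
  have range_d: "range d = D"
    unfolding d_def by (rule range_from_nat_into[OF \<open>D \<noteq> {}\<close> D(1)])
  define e where "e = gram_schmidt d"
  define P where "P n x = (\<Sum>k<n. cinner x (e k) *\<^sub>C e k)" for n x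
  have e: "e n = sgn (d n - P n (d n))" for n
    unfolding e_def P_def by (rule gram_schmidt.simps)
  have unit: "c * cinner (e k) (e k) = c" if "c = cinner x (e k)" for c k x
  proof (cases "e k = 0")
    case True
    then show ?thesis using that cinner_commute[of x 0] by (simp add: cinner_zero_left)
  next
    case False
    then have "norm (e k) = 1" unfolding e[of k] norm_sgn by (auto simp: sgn_zero_iff)
    then show ?thesis by (simp add: cinner_self)
  qed
  have res: "cinner (x - P n x) (e j) = 0"
    if "\<And>k. k < n \<Longrightarrow> k \<noteq> j \<Longrightarrow> cinner (e k) (e j) = 0" "j < n" for n j x
  proof -
    have "cinner (P n x) (e j) = (\<Sum>k<n. cinner x (e k) * cinner (e k) (e j))"
      by (simp add: P_def cinner_sum_left cinner_scaleC_left)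
    also have "\<dots> = (\<Sum>k<n. if k = j then cinner x (e j) else 0)"
      using that unit by (intro sum.cong) auto
    finally show ?thesis using \<open>j < n\<close> by (simp add: cinner_diff_left)
  qed
  have orth: "\<forall>j<n. \<forall>k<n. k \<noteq> j \<longrightarrow> cinner (e k) (e j) = 0" for n
  proof (induction n)
    case (Suc n)
    have "cinner (e n) (e j) = 0" if "j < n" for j
      unfolding e[of n] sgn_div_norm
      using res[of n j "d n"] Suc that by (simp add: cinner_scaleR_left)
    then have "cinner (e n) (e j) = 0" "cinner (e j) (e n) = 0" if "j < n" for j
      using that cinner_commute[of "e j" "e n"] by auto
    with Suc show ?case by (auto simp: less_Suc_eq)
  qed simp
  have step: "(norm (x - P (Suc n) x))\<^sup>2 = (norm (x - P n x))\<^sup>2 - (cmod (cinner x (e n)))\<^sup>2" for x n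
  proof -
    define y where "y = x - P n x"
    define c where "c = cinner x (e n)"
    have "cinner (P n x) (e n) = (\<Sum>k<n. cinner x (e k) * cinner (e k) (e n))"
      by (simp add: P_def cinner_sum_left cinner_scaleC_left)
    also have "\<dots> = 0" using orth[of "Suc n"] by (intro sum.neutral) auto
    finally have yc: "cinner y (e n) = c" by (simp add: y_def c_def cinner_diff_left)
    have eq: "x - P (Suc n) x = y - c *\<^sub>C e n" by (simp add: P_def y_def c_def)
    have "cinner (y - c *\<^sub>C e n) (e n) = 0"
      using unit[OF c_def] by (simp add: cinner_diff_left cinner_scaleC_left yc)
    then have z: "cinner (c *\<^sub>C e n) (y - c *\<^sub>C e n) = 0"
      using cinner_commute[of "e n" "y - c *\<^sub>C e n"] by (simp add: cinner_scaleC_left)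
    have "inner (c *\<^sub>C e n) (y - c *\<^sub>C e n) = 0" by (metis Re_cinner z zero_complex.sel(1))
    then have "(norm y)\<^sup>2 = (norm (y - c *\<^sub>C e n))\<^sup>2 + (norm (c *\<^sub>C e n))\<^sup>2"
      using dot_norm[of "c *\<^sub>C e n" "y - c *\<^sub>C e n"] by simp
    moreover have "(norm (c *\<^sub>C e n))\<^sup>2 = (cmod c)\<^sup>2"
    proof -
      have "complex_of_real ((norm (c *\<^sub>C e n))\<^sup>2) = cnj c * (c * cinner (e n) (e n))"
        unfolding norm_scaleC power_mult_distrib of_real_mult complex_norm_square cinner_self
        by (simp only: mult_ac)
      also have "\<dots> = complex_of_real ((cmod c)\<^sup>2)"
        unfolding unit[OF c_def] by (simp add: complex_norm_square mult.commute del: of_real_power)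
      finally show ?thesis using of_real_eq_iff by blast
    qed
    ultimately show ?thesis unfolding eq by (simp add: y_def c_def)
  qed
  have bessel: "(norm (x - P n x))\<^sup>2 = (norm x)\<^sup>2 - (\<Sum>k<n. (cmod (cinner x (e k)))\<^sup>2)" for x n
    by (induction n) (simp_all add: step, simp add: P_def)
  have mono: "norm (x - P n x) \<le> norm (x - P m x)" if "m \<le> n" for x m n
  proof (rule power2_le_imp_le)
    show "(norm (x - P n x))\<^sup>2 \<le> (norm (x - P m x))\<^sup>2"
      unfolding bessel using that by (intro diff_left_mono sum_mono2) auto
  qed simp
  have P_diff: "P n (x - y) = P n x - P n y" for n x y
    by (simp add: P_def cinner_diff_left complex_vector.scale_left_diff_distrib sum_subtractf)
  have hit: "d m - P (Suc m) (d m) = 0" for m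
  proof -
    define r where "r = d m - P m (d m)"
    have "cinner (P m (d m)) (e m) = (\<Sum>k<m. cinner (d m) (e k) * cinner (e k) (e m))"
      by (simp add: P_def cinner_sum_left cinner_scaleC_left)
    also have "\<dots> = 0" using orth[of "Suc m"] by (intro sum.neutral) auto
    finally have "cinner (d m) (e m) = cinner r (sgn r)"
      by (simp add: r_def cinner_diff_left e[of m])
    also have "\<dots> = of_real (norm r)"
      by (cases "r = 0") (simp_all add: sgn_div_norm cinner_scaleR_right cinner_self power2_eq_square)
    finally have "cinner (d m) (e m) *\<^sub>C e m = norm r *\<^sub>R sgn r"
      by (simp add: scaleC_of_real e[of m] r_def)
    also have "\<dots> = r" by (cases "r = 0") (simp_all add: sgn_div_norm)
    finally show ?thesis by (simp add: P_def r_def)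
  qed
  have lim: "(\<lambda>n. norm (x - P n x)) \<longlonglongrightarrow> 0" for x
  proof (rule LIMSEQ_I)
    fix \<epsilon> :: real assume "\<epsilon> > 0"
    then obtain m where m: "dist x (d m) < \<epsilon>"
      using D(2)[of "ball x \<epsilon>"] range_d by auto
    have "norm (x - P n x) < \<epsilon>" if "n \<ge> Suc m" for n
    proof -
      have "d m - P n (d m) = 0" using mono[OF that, of "d m"] hit[of m] by simp
      then have "x - P n x = (x - d m) - P n (x - d m)" by (simp add: P_diff algebra_simps)
      also have "norm \<dots> \<le> norm ((x - d m) - P 0 (x - d m))" by (rule mono) simp
      finally show ?thesis using m by (simp add: P_def dist_norm)
    qed
    then show "\<exists>n0. \<forall>n\<ge>n0. norm (norm (x - P n x) - 0) < \<epsilon>" by auto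
  qed
  have sums: "(\<lambda>k. (cmod (cinner x (e k)))\<^sup>2) sums (norm x)\<^sup>2" for x
  proof -
    have "(\<lambda>n. (norm x)\<^sup>2 - (norm (x - P n x))\<^sup>2) \<longlonglongrightarrow> (norm x)\<^sup>2 - 0\<^sup>2"
      by (intro tendsto_intros lim)
    then show ?thesis by (simp add: sums_def bessel)
  qed
  define J where "J x = Abs_ell2 (\<lambda>k. cinner x (e k))" for x
  have J: "ell2_nth (J x) = (\<lambda>k. cinner x (e k))" for x
    unfolding J_def using sums_summable[OF sums] by (intro Abs_ell2_inverse) simp
  have "clinear_on UNIV UNIV J"
    unfolding clinear_on_def
    by (auto simp: ell2_nth_inject[symmetric] J plus_ell2.rep_eq scaleC_ell2.rep_eq
        cinner_add_left cinner_scaleC_left)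
  moreover have "norm (J x) = norm x" for x
  proof -
    have "(norm (J x))\<^sup>2 = (norm x)\<^sup>2"
      unfolding ell2_norm_squared J by (rule sums_unique[OF sums, symmetric])
    then show ?thesis by simp
  qed
  ultimately show ?thesis by blast
qed

lemma clinear_onD:
  assumes "clinear_on UNIV Y f"
  shows "f (x + y) = f x + f y" "f (c *\<^sub>C x) = c *\<^sub>C f x" "f (x - y) = f x - f y" "f 0 = 0"
proof -
  show add: "f (x + y) = f x + f y" for x y using assms by (simp add: clinear_on_def)
  show "f (c *\<^sub>C x) = c *\<^sub>C f x" using assms by (simp add: clinear_on_def)
  show "f (x - y) = f x - f y" using add[of "x - y" y] by simp
  show "f 0 = 0" using add[of 0 0] by simp
qed

lemma optimal_systemD:
  fixes A' :: "'k::separable_hilbert_space \<Rightarrow> 'k"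
  assumes opt: "optimal_system \<Theta> A B"
    and pass: "passive_system UNIV A' B' C' D'" and real: "realizes UNIV A' B' C' D' \<Theta>"
  shows "norm (\<Sum>k\<le>n. (A ^^ k) (B (u k))) \<le> norm (\<Sum>k\<le>n. (A' ^^ k) (B' (u k)))"
proof -
  obtain J :: "'k \<Rightarrow> ell2" where lin: "clinear_on UNIV UNIV J" and iso: "\<And>x. norm (J x) = norm x"
    using isometry_ell2 by blast
  note J = clinear_onD[OF lin]
  have "linear J" by (rule linearI) (simp_all add: J scaleC_of_real[symmetric])
  then have blJ: "bounded_linear J"
    by (intro bounded_linear.intro bounded_linear_axioms.intro exI[of _ 1]) (auto simp: iso)
  have inj: "inj J"
  proof (rule injI)
    fix x y assume "J x = J y"
    then have "norm (J (x - y)) = 0" by (simp add: J)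
    then show "x = y" by (simp add: iso)
  qed
  define G where "G = inv J"
  have G: "G (J x) = x" for x unfolding G_def by (rule inv_f_f[OF inj])
  have "complete (J ` UNIV)"
    by (rule complete_isometric_image[of 1]) (auto simp: blJ iso complete_UNIV)
  then have clK: "closed (range J)" by (rule complete_imp_closed)
  have subK: "csubspace (range J)"
    unfolding complex_vector.subspace_def using J(1,2)[symmetric] J(4)
    by auto
  have linA: "clinear_on UNIV UNIV A'" and linB: "clinear_on UNIV UNIV B'"
    and linC: "clinear_on UNIV UNIV C'" and linD: "clinear_on UNIV UNIV D'"
    and contr: "\<And>h v. norm (block_op A' B' C' D' (h, v)) \<le> norm (h, v)"
    using pass by (auto simp: passive_system_def)
  note lins = clinear_onD[OF linA] clinear_onD[OF linB] clinear_onD[OF linC] clinear_onD[OF linD]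
  define A2 where "A2 = J \<circ> A' \<circ> G"
  define B2 where "B2 = J \<circ> B'"
  define C2 where "C2 = C' \<circ> G"
  have A2: "A2 (J x) = J (A' x)" and C2: "C2 (J x) = C' x" for x
    by (simp_all add: A2_def C2_def G)
  have pass2: "passive_system (range J) A2 B2 C2 D'"
    unfolding passive_system_def
  proof (intro conjI clK subK linD ballI allI)
    show "clinear_on (range J) (range J) A2"
      unfolding clinear_on_def by (auto simp: A2 lins J(1,2)[symmetric])
    show "clinear_on UNIV (range J) B2"
      unfolding clinear_on_def by (auto simp: B2_def lins J(1,2))
    show "clinear_on (range J) UNIV C2"
      unfolding clinear_on_def by (auto simp: C2 lins J(1,2)[symmetric])
    fix h v assume "h \<in> range J"
    then obtain x where h: "h = J x" by blast
    show "norm (block_op A2 B2 C2 D' (h, v)) \<le> norm (h, v)"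
      using contr[of x v] by (simp add: block_op_def h A2 C2 B2_def J(1)[symmetric] norm_Pair iso)
  qed
  have "transfer_function (range J) A2 B2 C2 D' z v = transfer_function UNIV A' B' C' D' z v"
    if z: "cmod z < 1" for z v
  proof -
    have cA: "norm (A' x) \<le> norm x" for x
    proof -
      have "norm (A' x) \<le> norm (A' x, C' x)" by (simp add: norm_Pair)
      also have "\<dots> \<le> norm x" using contr[of x 0] by (simp add: block_op_def lins norm_Pair)
      finally show ?thesis .
    qed
    have "\<exists>!x. B' v + z *\<^sub>C A' x = x"
    proof (rule banach_fix_type)
      show "\<forall>x y. dist (B' v + z *\<^sub>C A' x) (B' v + z *\<^sub>C A' y) \<le> cmod z * dist x y"
      proof (intro allI)
        fix x y
        have "dist (B' v + z *\<^sub>C A' x) (B' v + z *\<^sub>C A' y) = norm (z *\<^sub>C A' (x - y))"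
          by (simp add: dist_norm lins complex_vector.scale_right_diff_distrib)
        then show "dist (B' v + z *\<^sub>C A' x) (B' v + z *\<^sub>C A' y) \<le> cmod z * dist x y"
          using cA[of "x - y"] by (simp add: dist_norm norm_scaleC mult_left_mono)
      qed
    qed (use z in auto)
    then obtain x where x: "B' v + z *\<^sub>C A' x = x" and ux: "\<And>y. B' v + z *\<^sub>C A' y = y \<Longrightarrow> y = x"
      by blast
    have ux': "y = x" if "y - z *\<^sub>C A' y = B' v" for y
      using that by (intro ux) (simp flip: that)
    have 1: "inv_into UNIV (\<lambda>h. h - z *\<^sub>C A' h) (B' v) = x"
      unfolding inv_into_def by (rule some_equality) (use x ux' in \<open>auto simp: algebra_simps\<close>)
    have 2: "inv_into (range J) (\<lambda>h. h - z *\<^sub>C A2 h) (B2 v) = J x"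
      unfolding inv_into_def
    proof (rule some_equality)
      have eq: "J y - z *\<^sub>C A2 (J y) = J (y - z *\<^sub>C A' y)" for y by (simp add: A2 J)
      have "x - z *\<^sub>C A' x = B' v" using x by (simp add: algebra_simps)
      then show "J x \<in> range J \<and> J x - z *\<^sub>C A2 (J x) = B2 v" by (simp add: eq B2_def)
      fix h assume h: "h \<in> range J \<and> h - z *\<^sub>C A2 h = B2 v"
      then obtain y where y: "h = J y" by blast
      with h have "J (y - z *\<^sub>C A' y) = J (B' v)" by (simp add: eq B2_def)
      then show "h = J x" using ux' injD[OF inj] y by blast
    qed
    show ?thesis unfolding transfer_function_def 1 2 C2 by (rule refl)
  qed
  then have "realizes (range J) A2 B2 C2 D' \<Theta>"
    using real by (auto simp: realizes_def fun_eq_iff)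
  moreover have pow: "(A2 ^^ k) (B2 v) = J ((A' ^^ k) (B' v))" for k v
    by (induction k) (simp_all add: A2 B2_def)
  ultimately have "norm (\<Sum>k\<le>n. (A ^^ k) (B (u k))) \<le> norm (\<Sum>k\<le>n. (A2 ^^ k) (B2 (u k)))"
    using opt pass2 unfolding optimal_system_def by blast
  also have "(\<Sum>k\<le>n. (A2 ^^ k) (B2 (u k))) = J (\<Sum>k\<le>n. (A' ^^ k) (B' (u k)))"
    by (simp add: linear_sum[OF \<open>linear J\<close>] pow)
  finally show ?thesis by (simp only: iso)
qed

end

theory Submission
  imports Defs
begin

text \<open>
  Suppose \<open>0 \<le> Z \<le> I - T\<^sup>*T\<close> with range in the state space, and restrict \<open>Z\<close> to the state space.
  Let \<open>G = I - Z/2\<close>. Then \<open>I - Z \<le> G \<le> I\<close>, so the inequality \<open>Z \<le> I - T\<^sup>*T\<close> implies that the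
  system remains passive when the states are measured by the quadratic form of \<open>G\<close>. Since
  \<open>G \<ge> I/2\<close> is invertible, conjugation by its square root \<open>R\<close> gives a passive system with the
  same transfer function, and optimality gives \<open>\<parallel>x\<parallel> \<le> \<parallel>R x\<parallel>\<close>, that is \<open>\<langle>Z x, x\<rangle> \<le> 0\<close>, for
  every reachable state \<open>x\<close>. These are dense, so \<open>Z = 0\<close>.
\<close>

text \<open>The square root and resolvent lemmas below are stated for \<open>banach\<close>; this
  makes them apply to the state spaces.\<close>

instance separable_hilbert_space \<subseteq> banach ..

section \<open>Riesz representation and adjoints\<close>

text \<open>The polynomial vanishes at t = 0 and is minimal there, so its derivative 2b is zero.
  This is the first-variation argument used for Riesz and for kernels of nonnegative
  operators.\<close>

lemma linear_coeff_eq_0_if_quadratic_nonneg: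
  fixes a b :: real
  assumes "\<And>t. 0 \<le> a * t\<^sup>2 + 2 * b * t"
  shows "b = 0"
proof -
  \<comment> \<open>With a < 2s, the value at t = -b/s is negative unless b = 0.\<close>
  define s where "s = \<bar>a\<bar> + 1"
  have s: "s > 0" "a < 2 * s" by (auto simp: s_def)
  have "a * (- b / s)\<^sup>2 + 2 * b * (- b / s) = b\<^sup>2 * (a - 2 * s) / s\<^sup>2"
    using s by (simp add: field_simps power2_eq_square)
  with assms[of "- b / s"] have "0 \<le> b\<^sup>2 * (a - 2 * s) / s\<^sup>2" by simp
  then have "0 \<le> b\<^sup>2 * (a - 2 * s)" using s by (simp add: zero_le_divide_iff)
  then show ?thesis using s by (simp add: zero_le_mult_iff)
qed

text \<open>The representing vector minimizes \<open>\<parallel>x\<parallel>\<^sup>2 - 2 \<phi> x\<close>.\<close>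

lemma riesz_representation:
  fixes \<phi> :: "'a::{real_inner,complete_space} \<Rightarrow> real"
  assumes "bounded_linear \<phi>"
  shows "\<exists>z. \<forall>x. \<phi> x = inner x z"
proof -
  interpret bounded_linear \<phi> by fact
  obtain K where K: "\<And>x. norm (\<phi> x) \<le> norm x * K" using bounded by blast
  define F where "F x = inner x x - 2 * \<phi> x" for x
  have "- K\<^sup>2 \<le> F x" for x
  proof -
    have "\<phi> x \<le> norm x * K" using K[of x] by simp
    moreover have "2 * (norm x * K) \<le> (norm x)\<^sup>2 + K\<^sup>2"
      using sum_squares_bound[of "norm x" K] by simp
    ultimately show ?thesis by (simp add: F_def power2_norm_eq_inner)
  qed
  then have bdd: "bdd_below (range F)" by (auto simp: bdd_below_def)
  define m where "m = Inf (range F)"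
  have m: "m \<le> F x" for x unfolding m_def by (rule cInf_lower[OF _ bdd]) simp
  \<comment> \<open>Parallelogram law: the value of \<open>F\<close> at the midpoint is at least
    \<open>m\<close>, so near-minimizers are close together and a minimizing sequence is
    Cauchy.\<close>
  have par: "(norm (x - y))\<^sup>2 \<le> 2 * (F x - m) + 2 * (F y - m)" for x y
  proof -
    have "(norm (x - y))\<^sup>2 = 2 * F x + 2 * F y - 4 * F ((1/2) *\<^sub>R (x + y))"
      by (simp add: F_def power2_norm_eq_inner inner_add_left inner_add_right inner_diff_left
          inner_diff_right inner_commute scaleR add algebra_simps)
    then show ?thesis using m[of "(1/2) *\<^sub>R (x + y)"] by simp
  qed
  have "\<exists>x. F x < m + 1 / Suc n" for n
    using cInf_lessD[of "range F" "m + 1 / Suc n"] by (auto simp: m_def)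
  then obtain x where x: "\<And>n. F (x n) < m + 1 / Suc n" by metis
  have "Cauchy x"
  proof (rule metric_CauchyI)
    fix e :: real assume e: "e > 0"
    obtain N where N: "1 / real (Suc N) < e\<^sup>2 / 4"
      using nat_approx_posE[of "e\<^sup>2 / 4"] e by auto
    have F_less: "F (x k) < m + e\<^sup>2 / 4" if "k \<ge> N" for k
    proof -
      have "1 / real (Suc k) < e\<^sup>2 / 4"
        by (rule le_less_trans[OF _ N]) (use that in \<open>auto intro!: divide_left_mono\<close>)
      then show ?thesis using x[of k] add_strict_left_mono order.strict_trans by blast
    qed
    have "dist (x i) (x j) < e" if "i \<ge> N" "j \<ge> N" for i j
    proof -
      have "(norm (x i - x j))\<^sup>2 < e\<^sup>2"
        using par[of "x i" "x j"] F_less[OF that(1)] F_less[OF that(2)] by argo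
      then show ?thesis using e by (simp add: dist_norm power2_less_imp_less)
    qed
    then show "\<exists>M. \<forall>i\<ge>M. \<forall>j\<ge>M. dist (x i) (x j) < e" by blast
  qed
  then obtain z where z: "x \<longlonglongrightarrow> z" by (auto simp: Cauchy_convergent_iff convergent_def)
  have "F z \<le> m + 0"
  proof (rule LIMSEQ_le)
    show "(\<lambda>n. F (x n)) \<longlonglongrightarrow> F z" unfolding F_def by (intro tendsto_intros tendsto z)
    show "(\<lambda>n. m + 1 / real (Suc n)) \<longlonglongrightarrow> m + 0"
      by (intro tendsto_add tendsto_const LIMSEQ_Suc lim_1_over_n)
  qed (use x less_imp_le in blast)
  then have Fz: "F z \<le> F y" for y using m[of y] by simp
  have "\<phi> y = inner y z" for y
  proof -
    \<comment> \<open>This is half the derivative of \<open>F\<close> at the minimizer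
      \<open>z\<close> in direction \<open>y\<close>.\<close>
    have "inner y z - \<phi> y = 0"
    proof (rule linear_coeff_eq_0_if_quadratic_nonneg)
      fix t :: real
      show "0 \<le> inner y y * t\<^sup>2 + 2 * (inner y z - \<phi> y) * t"
        using Fz[of "z + t *\<^sub>R y"]
        by (simp add: F_def inner_add_left inner_add_right inner_commute scaleR add algebra_simps
            power2_eq_square)
    qed
    then show ?thesis by simp
  qed
  then show ?thesis by blast
qed

section \<open>Passage between real and complex inner products, and adjoints\<close>

lemma cinner_scaleC_right: "cinner x (a *\<^sub>C y) = cnj a * cinner x y" for x :: "'a::complex_inner"
  by (metis cinner_commute cinner_scaleC_left complex_cnj_mult)

lemma Im_cinner: "Im (cinner x y) = inner x (\<i> *\<^sub>C y)" for x :: "'a::complex_inner"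
  unfolding Re_cinner[symmetric] cinner_scaleC_right by simp

lemma inner_ii: "inner (\<i> *\<^sub>C x) (\<i> *\<^sub>C y) = inner x y" for x :: "'a::complex_inner"
  unfolding Re_cinner[symmetric] cinner_scaleC_right cinner_scaleC_left by simp

lemma ii_ii: "\<i> *\<^sub>C \<i> *\<^sub>C x = - x" for x :: "'a::complex_inner"
  using complex_vector.scale_minus_left[of 1 x] by (simp add: scaleC_scaleC scaleC_one)

text \<open>Imaginary parts are real inner products with the first argument turned by
  \<open>\<i>\<close>, and \<open>f\<close> commutes with that turn. Hence a real adjoint is already
  a complex one.\<close>

lemma cinner_eq_if_inner_eq:
  fixes f :: "'a::complex_inner \<Rightarrow> 'b::complex_inner" and g :: "'b \<Rightarrow> 'a"
  assumes f: "clinear_on UNIV UNIV f" and eq: "\<And>x y. inner (f x) y = inner x (g y)"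
  shows "cinner (f x) y = cinner x (g y)"
proof (rule complex_eqI)
  show "Re (cinner (f x) y) = Re (cinner x (g y))" by (simp add: Re_cinner eq)
  have *: "Im (cinner u v) = - inner (\<i> *\<^sub>C u) v" for u v :: "'c::complex_inner"
    unfolding Re_cinner[symmetric] cinner_scaleC_left by simp
  show "Im (cinner (f x) y) = Im (cinner x (g y))"
    unfolding * eq[symmetric] by (simp add: clinear_onD(2)[OF f])
qed

lemma bounded_linear_if_clinear:
  assumes f: "clinear_on UNIV UNIV f" and K: "\<And>x. norm (f x) \<le> K * norm x"
  shows "bounded_linear f"
  by (rule bounded_linear_intro[of _ K])
    (simp_all add: clinear_onD[OF f] K mult.commute scaleC_of_real[symmetric])

text \<open>\<open>cadjoint\<close> is a choice, so an adjoint must be exhibited first: the real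
  Riesz vector of x \<mapsto> \<open>inner (f x) y\<close>.\<close>

lemma cinner_cadjoint:
  fixes f :: "'a::{complex_inner,complete_space} \<Rightarrow> 'b::complex_inner"
  assumes f: "clinear_on UNIV UNIV f" "bounded_linear f"
  shows "cinner (f x) y = cinner x (cadjoint f y)"
proof -
  have "\<exists>z. \<forall>x. inner (f x) y = inner x z" for y
    by (intro riesz_representation bounded_linear_inner_left_comp f)
  then obtain g where "\<And>x y. inner (f x) y = inner x (g y)" by metis
  then have "\<forall>x y. cinner (f x) y = cinner x (g y)"
    using cinner_eq_if_inner_eq[OF f(1)] by blast
  then have "\<forall>x y. cinner (f x) y = cinner x (cadjoint f y)"
    unfolding cadjoint_def
    by (rule someI[where P = "\<lambda>g. \<forall>x y. cinner (f x) y = cinner x (g y)"])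
  then show ?thesis by blast
qed

section \<open>Nonnegative operators\<close>

text \<open>Over the complex numbers a real-valued quadratic form forces symmetry, by polarization;
  conversely symmetry makes the form real. Later arguments can then work with \<open>inner\<close>
  alone.\<close>

lemma nonneg_op_iff:
  "nonneg_op S \<longleftrightarrow> bounded_linear S \<and> clinear_on UNIV UNIV S \<and>
     (\<forall>x y. inner (S x) y = inner x (S y)) \<and> (\<forall>x. 0 \<le> inner (S x) x)"
  (is "?l \<longleftrightarrow> ?r")
proof
  assume S: ?l
  then have lin: "clinear_on UNIV UNIV S" and bl: "bounded_linear S"
    and re: "cinner (S x) x \<in> \<real>\<^sub>\<ge>\<^sub>0" for x
    by (auto simp: nonneg_op_def)
  note S_simps = clinear_onD[OF lin]
  have im: "inner (S x) (\<i> *\<^sub>C x) = 0" for x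
    using re[of x] by (simp add: Im_cinner[symmetric] complex_nonneg_Reals_iff)
  have cross: "inner (S x) (\<i> *\<^sub>C y) + inner (S y) (\<i> *\<^sub>C x) = 0" for x y
    using im[of "x + y"] by (simp add: S_simps inner_add_left inner_add_right scaleC_add_right im)
  have "inner (S x) y = inner x (S y)" for x y
    \<comment> \<open>Turning \<open>y\<close> by \<open>\<i>\<close> changes the sum in
      \<open>cross\<close> into the difference of the two sides.\<close>
    using cross[of x "\<i> *\<^sub>C y"] by (simp add: ii_ii S_simps inner_ii inner_commute)
  moreover have "0 \<le> inner (S x) x" for x
    using re[of x] by (simp add: Re_cinner[symmetric] complex_nonneg_Reals_iff)
  ultimately show ?r using lin bl by blast
next
  assume S: ?r
  then have lin: "clinear_on UNIV UNIV S" by blast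
  have im: "inner (S x) (\<i> *\<^sub>C x) = 0" for x
  proof -
    have "inner (S x) (\<i> *\<^sub>C x) = inner (\<i> *\<^sub>C S x) (\<i> *\<^sub>C \<i> *\<^sub>C x)"
      by (rule inner_ii[symmetric])
    also have "\<dots> = - inner (S (\<i> *\<^sub>C x)) x" by (simp add: clinear_onD(2)[OF lin] ii_ii)
    also have "\<dots> = - inner (S x) (\<i> *\<^sub>C x)" using S by (metis inner_commute)
    finally show ?thesis by simp
  qed
  show ?l
    unfolding nonneg_op_def complex_nonneg_Reals_iff Re_cinner Im_cinner using S im by blast
qed

lemma nonneg_opD:
  assumes "nonneg_op S"
  shows "bounded_linear S" "clinear_on UNIV UNIV S" "inner (S x) y = inner x (S y)"
    "0 \<le> inner (S x) x"
  using assms unfolding nonneg_op_iff by blast+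

lemma op_leD: "op_le Z S \<Longrightarrow> inner (Z x) x \<le> inner (S x) x"
  using nonneg_opD(4)[of "\<lambda>x. S x - Z x" x] by (simp add: op_le_def inner_diff_left)

lemma nonneg_op_zero: "nonneg_op (\<lambda>_. 0)"
  by (simp add: nonneg_op_iff bounded_linear_zero clinear_on_def)

text \<open>Along the line x + t S x the form is nonnegative with no constant term, and its linear
  coefficient is twice the squared norm of S x.\<close>

lemma nonneg_op_apply_eq_0:
  assumes S: "nonneg_op S" and x: "inner (S x) x \<le> 0"
  shows "S x = 0"
proof -
  have 0: "inner (S x) x = 0" using x nonneg_opD(4)[OF S, of x] by simp
  have "inner (S x) (S x) = 0"
  proof (rule linear_coeff_eq_0_if_quadratic_nonneg)
    fix t :: real
    interpret bounded_linear S by (rule nonneg_opD(1)[OF S])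
    show "0 \<le> inner (S (S x)) (S x) * t\<^sup>2 + 2 * inner (S x) (S x) * t"
      using nonneg_opD(4)[OF S, of "x + t *\<^sub>R S x"] 0 nonneg_opD(3)[OF S, of "S x" x]
      by (simp add: add scaleR inner_add_left inner_add_right power2_eq_square algebra_simps)
  qed
  then show ?thesis by simp
qed

lemma nonneg_op_norm_le:
  assumes S: "nonneg_op S" and le: "\<And>x. inner (S x) x \<le> (norm x)\<^sup>2"
  shows "norm (S x) \<le> norm x"
proof (cases "S x = 0")
  case False
  interpret bounded_linear S by (rule nonneg_opD(1)[OF S])
  \<comment> \<open>The vector \<open>y\<close> points along S x and has the norm of
    \<open>x\<close>. Polarization then bounds the norm of S x using only values of the
    form.\<close>
  define y where "y = (norm x / norm (S x)) *\<^sub>R S x"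
  have "4 * inner (S x) y = inner (S (x + y)) (x + y) - inner (S (x - y)) (x - y)"
    using nonneg_opD(3)[OF S, of x y]
    by (simp add: add diff inner_add_left inner_add_right inner_diff_left inner_diff_right
        inner_commute)
  also have "\<dots> \<le> (norm (x + y))\<^sup>2" using le[of "x + y"] nonneg_opD(4)[OF S, of "x - y"] by simp
  also have "\<dots> \<le> (2 * norm x)\<^sup>2"
    using norm_triangle_ineq[of x y] False by (intro power_mono) (simp_all add: y_def)
  finally have "inner (S x) y \<le> (norm x)\<^sup>2" by (simp add: power_mult_distrib)
  moreover have "inner (S x) y = norm x * norm (S x)"
    using False by (simp add: y_def power2_norm_eq_inner[symmetric] power2_eq_square)
  moreover have "x \<noteq> 0" using False zero by blast
  ultimately show ?thesis by (simp add: power2_eq_square)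
qed simp

lemma scaleR_scaleC: "r *\<^sub>R c *\<^sub>C x = c *\<^sub>C r *\<^sub>R x" for x :: "'a::complex_inner"
  by (metis scaleC_of_real scaleC_scaleC mult.commute)

lemma nonneg_op_half:
  assumes S: "nonneg_op S"
  shows "nonneg_op (\<lambda>x. (1/2) *\<^sub>R S x)"
  unfolding nonneg_op_iff
proof (intro conjI allI)
  show "bounded_linear (\<lambda>x. (1/2) *\<^sub>R S x)"
    by (rule bounded_linear_compose[OF bounded_linear_scaleR_right nonneg_opD(1)[OF S]])
  show "clinear_on UNIV UNIV (\<lambda>x. (1/2) *\<^sub>R S x)"
    by (simp add: clinear_on_def clinear_onD[OF nonneg_opD(2)[OF S]] scaleR_add_right scaleR_scaleC)
  show "inner ((1/2) *\<^sub>R S x) y = inner x ((1/2) *\<^sub>R S y)" for x y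
    by (simp add: nonneg_opD(3)[OF S])
  show "0 \<le> inner ((1/2) *\<^sub>R S x) x" for x
    using nonneg_opD(4)[OF S, of x] by simp
qed

lemma nonneg_op_one_minus:
  assumes S: "nonneg_op S" and le: "\<And>x. inner (S x) x \<le> (norm x)\<^sup>2"
  shows "nonneg_op (\<lambda>x. x - S x)"
  unfolding nonneg_op_iff
proof (intro conjI allI)
  show "bounded_linear (\<lambda>x. x - S x)"
    by (intro bounded_linear_sub bounded_linear_ident nonneg_opD(1)[OF S])
  show "clinear_on UNIV UNIV (\<lambda>x. x - S x)"
    by (simp add: clinear_on_def clinear_onD[OF nonneg_opD(2)[OF S]]
        complex_vector.scale_right_diff_distrib)
  show "inner (x - S x) y = inner x (y - S y)" for x y
    by (simp add: inner_diff_left inner_diff_right nonneg_opD(3)[OF S])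
  show "0 \<le> inner (x - S x) x" for x
    using le[of x] by (simp add: inner_diff_left power2_norm_eq_inner)
qed

section \<open>Square roots\<close>

text \<open>
  The binomial series of \<open>\<surd>(1 - t)\<close> has absolutely summable coefficients, so it applies to
  \<open>X = I - P\<close> even when \<open>\<parallel>X\<parallel> = 1\<close>.
\<close>

definition sqrt_coeff :: "nat \<Rightarrow> real" where
  "sqrt_coeff n = (1/2 gchoose n) * (-1) ^ n"

lemma sqrt_coeff_0: "sqrt_coeff 0 = 1"
  by (simp add: sqrt_coeff_def)

text \<open>The coefficient is the rising factorial of -1/2 over \<open>fact (Suc n)\<close>; its
  first factor is negative and all others are positive.\<close>

lemma sqrt_coeff_Suc: "sqrt_coeff (Suc n) \<le> 0"
proof -
  have "sqrt_coeff (Suc n) = - (1/2) * pochhammer (1/2) n / fact (Suc n)"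
    unfolding sqrt_coeff_def gbinomial_pochhammer pochhammer_rec
    by (simp flip: power_mult_distrib)
  also have "\<dots> \<le> 0"
    using pochhammer_nonneg[of "1/2 :: real" n] by (simp add: divide_nonpos_pos)
  finally show ?thesis .
qed

text \<open>Alternating partial sums of binomial coefficients telescope to a single one. The sign
  serves both absolute summability and positivity of the square root.\<close>

lemma sum_sqrt_coeff_nonneg: "0 \<le> (\<Sum>k\<le>n. sqrt_coeff k)"
proof -
  have "(\<Sum>k\<le>n. sqrt_coeff k) = pochhammer (1/2) n / fact n"
    unfolding sqrt_coeff_def gbinomial_sum_lower_neg
    by (simp add: gbinomial_pochhammer flip: power_mult_distrib)
  then show ?thesis using pochhammer_nonneg[of "1/2 :: real" n] by simp
qed

text \<open>Only the coefficient 1 at index 0 is positive, so the sum of absolute values is 2 minus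
  the plain partial sum.\<close>

lemma summable_abs_sqrt_coeff: "summable (\<lambda>n. \<bar>sqrt_coeff n\<bar>)"
proof (rule bounded_imp_summable)
  fix n
  have "(\<Sum>k\<le>n. \<bar>sqrt_coeff k\<bar>) = 2 - (\<Sum>k\<le>n. sqrt_coeff k)"
    by (induction n) (auto simp: sqrt_coeff_0 sqrt_coeff_Suc abs_of_nonpos)
  then show "(\<Sum>k\<le>n. \<bar>sqrt_coeff k\<bar>) \<le> 2" using sum_sqrt_coeff_nonneg[of n] by simp
qed simp

text \<open>The formal square of the series is 1 - t; on coefficients this is Vandermonde with 1/2 +
  1/2 = 1.\<close>

lemma sqrt_coeff_convolution:
  "(\<Sum>k\<le>n. sqrt_coeff k * sqrt_coeff (n - k)) = (if n = 0 then 1 else if n = 1 then -1 else 0)"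
proof -
  have "(\<Sum>k\<le>n. sqrt_coeff k * sqrt_coeff (n - k)) =
      (\<Sum>k\<le>n. (1/2 gchoose k) * (1/2 gchoose (n - k)) * (-1) ^ n)"
    by (intro sum.cong) (auto simp: sqrt_coeff_def power_add[symmetric])
  also have "\<dots> = (1 gchoose n) * (-1) ^ n"
    using gbinomial_Vandermonde[of "1/2 :: real" "1/2" n]
    by (simp add: sum_distrib_right[symmetric] atMost_atLeast0)
  also have "(1 :: real) gchoose n = of_nat (1 choose n)" by (simp add: binomial_gbinomial)
  finally show ?thesis by (auto simp: binomial_eq_0)
qed

text \<open>The root is the series of the square root of 1 - t evaluated at \<open>X\<close> = I -
  P. The bounds 0 \<le> P \<le> I make \<open>X\<close> a nonnegative contraction, so the series
  converges absolutely at every vector.\<close>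

lemma nonneg_op_sqrt_exists:
  fixes P :: "'a::{complex_inner,banach} \<Rightarrow> 'a"
  assumes P: "nonneg_op P" and le: "\<And>x. inner (P x) x \<le> (norm x)\<^sup>2"
  shows "\<exists>R. nonneg_op R \<and> R \<circ> R = P"
proof -
  define X where "X x = x - P x" for x
  have X: "nonneg_op X" unfolding X_def[abs_def] by (rule nonneg_op_one_minus[OF P le])
  have Xle: "norm (X x) \<le> norm x" for x
    by (rule nonneg_op_norm_le[OF X])
      (use nonneg_opD(4)[OF P] in \<open>simp add: X_def inner_diff_left power2_norm_eq_inner\<close>)
  note Xlin = clinear_onD[OF nonneg_opD(2)[OF X]]
  let ?a = sqrt_coeff
  have Xn: "bounded_linear (X ^^ n)" for n
    by (induction n)
      (simp_all add: id_def bounded_linear_ident comp_def bounded_linear_compose nonneg_opD(1)[OF X])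
  have Xn_C: "(X ^^ n) (c *\<^sub>C x) = c *\<^sub>C (X ^^ n) x" for n c x
    by (induction n) (simp_all add: Xlin)
  have Xn_adj: "inner ((X ^^ n) x) y = inner x ((X ^^ n) y)" for n x y
    by (induction n arbitrary: x y) (simp_all add: nonneg_opD(3)[OF X] funpow_swap1)
  have Xn_le: "norm ((X ^^ n) x) \<le> norm x" for n x
    by (induction n) (auto intro: order_trans[OF Xle])
  define R where "R x = (\<Sum>n. ?a n *\<^sub>R (X ^^ n) x)" for x
  have bound: "norm (?a n *\<^sub>R (X ^^ n) x) \<le> \<bar>?a n\<bar> * norm x" for n x
    by (simp add: mult_left_mono Xn_le)
  have ns: "summable (\<lambda>n. norm (?a n *\<^sub>R (X ^^ n) x))" for x
    using bound by (intro summable_comparison_test'[OF summable_mult2[OF summable_abs_sqrt_coeff]]) auto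
  have sums: "(\<lambda>n. ?a n *\<^sub>R (X ^^ n) x) sums R x" for x
    unfolding R_def using summable_norm_cancel[OF ns] by (rule summable_sums)
  have hs: "((\<lambda>n. ?a n *\<^sub>R (X ^^ n) x) has_sum R x) UNIV" for x
    by (rule norm_summable_imp_has_sum[OF ns sums])
  have Rlin: "clinear_on UNIV UNIV R"
    unfolding clinear_on_def
  proof (intro conjI ballI allI)
    fix x y c
    have "(\<lambda>n. ?a n *\<^sub>R (X ^^ n) (x + y)) sums (R x + R y)"
      using sums_add[OF sums[of x] sums[of y]]
      by (simp add: bounded_linear.linear[OF Xn] linear_add scaleR_add_right)
    then show "R (x + y) = R x + R y" using sums sums_unique2 by blast
    have "bounded_linear (\<lambda>x :: 'a. c *\<^sub>C x)"
      by (rule bounded_linear_if_clinear[of _ "cmod c"])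
        (auto simp: clinear_on_def scaleC_add_right scaleC_scaleC mult.commute norm_scaleC)
    from bounded_linear.sums[OF this sums[of x]]
    have "(\<lambda>n. ?a n *\<^sub>R (X ^^ n) (c *\<^sub>C x)) sums (c *\<^sub>C R x)"
      by (simp add: Xn_C scaleC_of_real[symmetric] scaleC_scaleC mult.commute)
    then show "R (c *\<^sub>C x) = c *\<^sub>C R x" using sums sums_unique2 by blast
  qed simp
  have "norm (R x) \<le> (\<Sum>n. \<bar>?a n\<bar>) * norm x" for x
  proof -
    have "norm (R x) \<le> (\<Sum>n. norm (?a n *\<^sub>R (X ^^ n) x))"
      unfolding R_def by (rule summable_norm[OF ns])
    also have "\<dots> \<le> (\<Sum>n. \<bar>?a n\<bar> * norm x)"
      by (rule suminf_le[OF bound ns summable_mult2[OF summable_abs_sqrt_coeff]])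
    finally show ?thesis using suminf_mult2[OF summable_abs_sqrt_coeff] by simp
  qed
  then have Rbl: "bounded_linear R" by (rule bounded_linear_if_clinear[OF Rlin])
  have Radj: "inner (R x) y = inner x (R y)" for x y
  proof -
    have "(\<lambda>n. inner (?a n *\<^sub>R (X ^^ n) x) y) sums inner (R x) y"
      by (rule bounded_linear.sums[OF bounded_linear_inner_left sums])
    moreover have "(\<lambda>n. inner x (?a n *\<^sub>R (X ^^ n) y)) sums inner x (R y)"
      by (rule bounded_linear.sums[OF bounded_linear_inner_right sums])
    ultimately show ?thesis using sums_unique2 by (simp add: Xn_adj)
  qed
  have Rpos: "0 \<le> inner (R x) x" for x
  proof (rule LIMSEQ_le_const)
    have "(\<lambda>n. inner (?a n *\<^sub>R (X ^^ n) x) x) sums inner (R x) x"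
      by (rule bounded_linear.sums[OF bounded_linear_inner_left sums])
    then show "(\<lambda>n. \<Sum>k\<le>n. inner (?a k *\<^sub>R (X ^^ k) x) x) \<longlonglongrightarrow> inner (R x) x"
      by (simp only: sums_def_le)
    \<comment> \<open>The term k = 0 is an equality. For k > 0 the coefficient is nonpositive and
      the form of \<open>X ^^ k\<close> is at most the squared norm.\<close>
    have "(\<Sum>k\<le>n. ?a k) * (norm x)\<^sup>2 \<le> (\<Sum>k\<le>n. inner (?a k *\<^sub>R (X ^^ k) x) x)" for n
      unfolding sum_distrib_right
    proof (rule sum_mono)
      fix k
      have "inner ((X ^^ k) x) x \<le> norm x * norm x"
        using norm_cauchy_schwarz[of "(X ^^ k) x" x] mult_right_mono[OF Xn_le[of k x], of "norm x"]
        by simp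
      then show "?a k * (norm x)\<^sup>2 \<le> inner (?a k *\<^sub>R (X ^^ k) x) x"
        by (cases k) (auto simp: sqrt_coeff_0 power2_norm_eq_inner sqrt_coeff_Suc power2_eq_square
            norm_eq_sqrt_inner intro!: mult_left_mono_neg)
    qed
    then show "\<exists>N. \<forall>n\<ge>N. 0 \<le> (\<Sum>k\<le>n. inner (?a k *\<^sub>R (X ^^ k) x) x)"
      by (meson order_trans mult_nonneg_nonneg sum_sqrt_coeff_nonneg zero_le_power2)
  qed
  have "R (R x) = P x" for x
  proof -
    \<comment> \<open>This absolutely summable family is summed twice: by rows it gives R (R x), by
      antidiagonals it gives x - X x.\<close>
    define f where "f = (\<lambda>(n, m). (?a n * ?a m) *\<^sub>R (X ^^ (n + m)) x)"
    have asum: "(\<lambda>n. \<bar>?a n\<bar>) summable_on UNIV"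
      by (rule summable_nonneg_imp_summable_on[OF summable_abs_sqrt_coeff]) simp
    have "(\<lambda>p. norm ((\<lambda>(n, m). ?a n * ?a m) p)) summable_on UNIV \<times> UNIV"
      by (rule Infinite_Sum.abs_summable_on_Sigma_iff[THEN iffD2])
        (use asum in \<open>auto simp: abs_mult infsum_cmult_right intro!: summable_on_cmult_right
          summable_on_cmult_left infsum_nonneg\<close>)
    then have "(\<lambda>p. norm ((\<lambda>(n, m). ?a n * ?a m) p) * norm x) summable_on UNIV \<times> UNIV"
      by (rule summable_on_cmult_left)
    then have "(\<lambda>p. norm (f p)) summable_on UNIV \<times> UNIV"
      by (rule Infinite_Sum.abs_summable_on_comparison_test')
        (auto simp: f_def mult_left_mono Xn_le simp del: funpow_add)
    then obtain S where S: "(f has_sum S) (UNIV \<times> UNIV)"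
      using Infinite_Sum.abs_summable_summable summable_on_def by blast
    have "((\<lambda>n. ?a n *\<^sub>R (X ^^ n) (R x)) has_sum S) UNIV"
    proof (rule has_sum_SigmaD[OF S])
      fix n
      have "bounded_linear (\<lambda>v. ?a n *\<^sub>R (X ^^ n) v)"
        by (intro bounded_linear_compose[OF bounded_linear_scaleR_right] Xn)
      from has_sum_bounded_linear[OF this hs[of x]]
      show "((\<lambda>m. f (n, m)) has_sum ?a n *\<^sub>R (X ^^ n) (R x)) UNIV"
        by (simp add: f_def funpow_add bounded_linear.linear[OF Xn] linear_scale)
    qed
    then have 1: "S = R (R x)" using hs has_sum_unique by blast
    \<comment> \<open>Here k = n + m numbers the antidiagonal and i = n is the position on
      it.\<close>
    have "((\<lambda>(k, i). f (i, k - i)) has_sum S) (SIGMA k:UNIV. {..k})"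
      using S by (subst has_sum_reindex_bij_witness[of _ "\<lambda>(n, m). (n + m, n)" "\<lambda>(k, i). (i, k - i)"
            "UNIV \<times> UNIV" f _ S S]) auto
    then have "((\<lambda>k. \<Sum>i\<le>k. f (i, k - i)) has_sum S) UNIV"
      by (rule has_sum_SigmaD) (simp add: has_sum_finite)
    moreover have "(\<Sum>i\<le>k. f (i, k - i)) = (\<Sum>i\<le>k. ?a i * ?a (k - i)) *\<^sub>R (X ^^ k) x" for k
      unfolding scaleR_sum_left by (intro sum.cong) (auto simp: f_def)
    ultimately have "((\<lambda>k. (if k = 0 then 1 else if k = 1 then -1 else 0) *\<^sub>R (X ^^ k) x)
        has_sum S) UNIV"
      by (simp only: sqrt_coeff_convolution)
    then have "((\<lambda>k. (if k = 0 then 1 else if k = 1 then -1 else 0) *\<^sub>R (X ^^ k) x)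
        has_sum S) {0, 1}"
      by (rule has_sum_cong_neutral[THEN iffD1, rotated -1]) auto
    then have "S = x - X x" by (subst (asm) has_sum_finite_iff) auto
    with 1 show ?thesis by (simp add: X_def)
  qed
  then show ?thesis
    using Rlin Rbl Radj Rpos by (intro exI[of _ R]) (auto simp: nonneg_op_iff)
qed

lemma sqrt_op_square:
  fixes P :: "'a::{complex_inner,banach} \<Rightarrow> 'a"
  assumes "nonneg_op P" and "\<And>x. inner (P x) x \<le> (norm x)\<^sup>2"
  shows "sqrt_op P \<circ> sqrt_op P = P"
  using someI_ex[OF nonneg_op_sqrt_exists[OF assms]] unfolding sqrt_op_def by blast

text \<open>This replaces the squared defect operator by the energy lost under \<open>T\<close>,
  which turns the operator inequality of the shorted operator into one between norms.\<close>

lemma defect_op_square: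
  fixes T :: "'a::{complex_inner,banach} \<Rightarrow> 'b::complex_inner"
  assumes lin: "clinear_on UNIV UNIV T" and contr: "\<And>x. norm (T x) \<le> norm x"
  shows "nonneg_op (defect_op T \<circ> defect_op T)"
    and "inner ((defect_op T \<circ> defect_op T) x) x = (norm x)\<^sup>2 - (norm (T x))\<^sup>2"
proof -
  have bl: "bounded_linear T"
    by (rule bounded_linear_if_clinear[OF lin, of 1]) (simp add: contr)
  note Tlin = clinear_onD[OF lin]
  have adj: "cinner x (cadjoint T y) = cinner (T x) y" for x y
    by (rule cinner_cadjoint[OF lin bl, symmetric])
  have adj_inner: "inner x (cadjoint T y) = inner (T x) y" for x y
    using adj by (simp flip: Re_cinner)
  have adj_le: "norm (cadjoint T y) \<le> norm y" for y
  proof -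
    have "(norm (cadjoint T y))\<^sup>2 = inner (T (cadjoint T y)) y"
      by (simp add: power2_norm_eq_inner adj_inner)
    also have "\<dots> \<le> norm (cadjoint T y) * norm y"
      using norm_cauchy_schwarz mult_right_mono[OF contr] norm_ge_zero order_trans by blast
    finally show ?thesis
      by (cases "cadjoint T y = 0") (auto simp: power2_eq_square)
  qed
  have adj_lin: "clinear_on UNIV UNIV (cadjoint T)"
    unfolding clinear_on_def
  proof (intro conjI ballI allI)
    fix x y c
    show "cadjoint T (x + y) = cadjoint T x + cadjoint T y"
      by (subst vector_eq_ldot[symmetric]) (simp add: adj_inner inner_add_right)
    show "cadjoint T (c *\<^sub>C x) = c *\<^sub>C cadjoint T x"
      by (subst vector_eq_ldot[symmetric]) (simp add: adj cinner_scaleC_right flip: Re_cinner)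
  qed simp
  have TT: "nonneg_op (\<lambda>x. cadjoint T (T x))"
    unfolding nonneg_op_iff
  proof (intro conjI allI)
    show l: "clinear_on UNIV UNIV (\<lambda>x. cadjoint T (T x))"
      unfolding clinear_on_def by (simp add: Tlin clinear_onD[OF adj_lin])
    show "bounded_linear (\<lambda>x. cadjoint T (T x))"
      by (rule bounded_linear_if_clinear[OF l, of 1]) (use order_trans[OF adj_le contr] in simp)
  qed (auto simp: adj_inner inner_commute[of "cadjoint T _"] intro: inner_commute)
  have q: "inner (cadjoint T (T x)) x = (norm (T x))\<^sup>2" for x
    by (simp add: inner_commute[of "cadjoint T _"] adj_inner power2_norm_eq_inner)
  have nn: "nonneg_op (\<lambda>x. x - cadjoint T (T x))"
    by (rule nonneg_op_one_minus[OF TT]) (simp add: q power_mono contr)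
  have q': "inner (x - cadjoint T (T x)) x = (norm x)\<^sup>2 - (norm (T x))\<^sup>2" for x
    by (simp only: inner_diff_left q power2_norm_eq_inner)
  have sq: "defect_op T \<circ> defect_op T = (\<lambda>x. x - cadjoint T (T x))"
    unfolding defect_op_def by (rule sqrt_op_square[OF nn]) (simp add: q')
  show "nonneg_op (defect_op T \<circ> defect_op T)" unfolding sq by (rule nn)
  show "inner ((defect_op T \<circ> defect_op T) x) x = (norm x)\<^sup>2 - (norm (T x))\<^sup>2"
    unfolding sq by (rule q')
qed

section \<open>Rescaling the state space\<close>

text \<open>Banach's fixed point theorem for x \<mapsto> b + z A x. Uniqueness pins down the inverse
  chosen in \<open>transfer_function\<close>; the case z = 1/2 also inverts I - Z/2 below.\<close>

lemma ex1_resolvent: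
  fixes A :: "'h::{complex_inner,banach} \<Rightarrow> 'h"
  assumes lin: "clinear_on UNIV UNIV A" and contr: "\<And>x. norm (A x) \<le> norm x" and z: "cmod z < 1"
  shows "\<exists>!x. x - z *\<^sub>C A x = b"
proof -
  note lins = clinear_onD[OF lin]
  have "\<exists>!x. b + z *\<^sub>C A x = x"
  proof (rule banach_fix_type)
    show "\<forall>x y. dist (b + z *\<^sub>C A x) (b + z *\<^sub>C A y) \<le> cmod z * dist x y"
    proof (intro allI)
      fix x y
      have "dist (b + z *\<^sub>C A x) (b + z *\<^sub>C A y) = norm (z *\<^sub>C A (x - y))"
        by (simp add: dist_norm lins complex_vector.scale_right_diff_distrib)
      then show "dist (b + z *\<^sub>C A x) (b + z *\<^sub>C A y) \<le> cmod z * dist x y"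
        using contr[of "x - y"] by (simp add: dist_norm norm_scaleC mult_left_mono)
    qed
  qed (use z in auto)
  moreover have "b + z *\<^sub>C A x = x \<longleftrightarrow> x - z *\<^sub>C A x = b" for x
    by (auto simp: algebra_simps)
  ultimately show ?thesis by simp
qed

lemma passive_system_state_contraction:
  assumes "passive_system UNIV A B C D"
  shows "norm (A x) \<le> norm x"
proof -
  have "B 0 = 0" "D 0 = 0"
    using assms by (auto simp: passive_system_def clinear_onD(4))
  moreover have "norm (block_op A B C D (x, 0)) \<le> norm (x, 0 :: 'b)"
    using assms unfolding passive_system_def by blast
  ultimately have "norm (A x, C x) \<le> norm x" by (simp add: block_op_def norm_Pair)
  then show ?thesis using norm_fst_le[of "A x" "C x"] by simp
qed

lemma inv_eq_if_unique:
  assumes "f x = y" and "\<And>x'. f x' = y \<Longrightarrow> x' = x"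
  shows "inv f y = x"
  using assms by (metis f_inv_into_f rangeI)

text \<open>\<open>R\<close> carries the solution of the resolvent equation to that of the
  conjugated one, and \<open>inv R\<close> in the output map undoes it.\<close>

lemma realizes_conjugate:
  fixes A :: "'h::{complex_inner,banach} \<Rightarrow> 'h" and R :: "'h \<Rightarrow> 'k::complex_inner"
  assumes pass: "passive_system UNIV A B C D" and real: "realizes UNIV A B C D \<Theta>"
    and lin: "clinear_on UNIV UNIV R" and bij: "bij R"
  shows "realizes UNIV (R \<circ> A \<circ> inv R) (R \<circ> B) (C \<circ> inv R) D \<Theta>"
proof -
  note Rlin = clinear_onD[OF lin]
  have inv[simp]: "inv R (R x) = x" "R (inv R y) = y" for x y
    using bij by (simp_all add: bij_is_inj bij_is_surj surj_f_inv_f)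
  have "transfer_function UNIV (R \<circ> A \<circ> inv R) (R \<circ> B) (C \<circ> inv R) D z v =
      transfer_function UNIV A B C D z v" if z: "cmod z < 1" for z v
  proof -
    have "clinear_on UNIV UNIV A" using pass by (simp add: passive_system_def)
    from ex1_resolvent[OF this passive_system_state_contraction[OF pass] z, of "B v"]
    obtain x where x: "x - z *\<^sub>C A x = B v" and uniq: "\<And>y. y - z *\<^sub>C A y = B v \<Longrightarrow> y = x"
      by blast
    have 1: "inv (\<lambda>h. h - z *\<^sub>C A h) (B v) = x"
      by (rule inv_eq_if_unique) (fact x, fact uniq)
    have eq: "y - z *\<^sub>C R (A (inv R y)) = R (inv R y - z *\<^sub>C A (inv R y))" for y
      by (simp add: Rlin)
    have 2: "inv (\<lambda>h. h - z *\<^sub>C (R \<circ> A \<circ> inv R) h) ((R \<circ> B) v) = R x"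
    proof (rule inv_eq_if_unique)
      show "R x - z *\<^sub>C (R \<circ> A \<circ> inv R) (R x) = (R \<circ> B) v"
        by (simp add: Rlin(2,3)[symmetric] x)
      fix h assume "h - z *\<^sub>C (R \<circ> A \<circ> inv R) h = (R \<circ> B) v"
      then have "R (inv R h - z *\<^sub>C A (inv R h)) = R (B v)" unfolding eq[symmetric] by simp
      then have "inv R h = x" by (rule uniq[OF injD[OF bij_is_inj[OF bij]]])
      then show "h = R x" by auto
    qed
    show ?thesis unfolding transfer_function_def 1 2 by simp
  qed
  with real show ?thesis by (auto simp: realizes_def fun_eq_iff)
qed

text \<open>
  Halving \<open>Z\<close> keeps \<open>I - Z/2\<close> bounded below, so that its square root is invertible and no completion
  of the state space is needed.
\<close>

lemma optimal_system_dissipation_eq_0: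
  fixes A :: "'h::separable_hilbert_space \<Rightarrow> 'h" and B :: "'m::separable_hilbert_space \<Rightarrow> 'h"
    and C :: "'h \<Rightarrow> 'n::separable_hilbert_space"
  assumes pass: "passive_system UNIV A B C D" and real: "realizes UNIV A B C D \<Theta>"
    and opt: "optimal_system \<Theta> A B" and Z: "nonneg_op Z"
    and dis: "\<And>h u. (norm (A h + B u))\<^sup>2 + (norm (C h + D u))\<^sup>2 + inner (Z h) h
      \<le> (norm h)\<^sup>2 + (norm u)\<^sup>2"
  shows "Z ((A ^^ n) (B v)) = 0"
proof -
  have lins: "clinear_on UNIV UNIV A" "clinear_on UNIV UNIV B" "clinear_on UNIV UNIV C"
    "clinear_on UNIV UNIV D"
    using pass by (auto simp: passive_system_def)
  note lin_simps = lins[THEN clinear_onD(1)] lins[THEN clinear_onD(2)] lins[THEN clinear_onD(4)]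
  define Y where "Y x = (1/2) *\<^sub>R Z x" for x
  have Y: "nonneg_op Y" unfolding Y_def[abs_def] by (rule nonneg_op_half[OF Z])
  have Z_le: "inner (Z x) x \<le> (norm x)\<^sup>2" for x
    using dis[of x 0] by (simp add: lin_simps) (smt (verit) zero_le_power2)
  have Y_le: "inner (Y x) x \<le> (norm x)\<^sup>2" for x
    using Z_le[of x] nonneg_opD(4)[OF Z, of x] by (simp add: Y_def)
  have "nonneg_op (\<lambda>x. x - Y x)" by (rule nonneg_op_one_minus[OF Y Y_le])
  moreover have "inner (x - Y x) x \<le> (norm x)\<^sup>2" for x
    using nonneg_opD(4)[OF Y, of x] by (simp add: inner_diff_left power2_norm_eq_inner)
  ultimately obtain R where R: "nonneg_op R" "R \<circ> R = (\<lambda>x. x - Y x)"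
    using nonneg_op_sqrt_exists by blast
  have RR: "R (R x) = x - (1/2) *\<^sub>R Z x" for x using fun_cong[OF R(2), of x] by (simp add: Y_def)
  \<comment> \<open>By symmetry of \<open>R\<close> the squared norm of R x is the form of R R = I -
    Z/2: states are now measured by the new weight.\<close>
  have normR: "(norm (R x))\<^sup>2 = (norm x)\<^sup>2 - inner (Z x) x / 2" for x
    using nonneg_opD(3)[OF R(1), of "R x" x]
    by (simp add: power2_norm_eq_inner RR inner_diff_left)
  note Rlin = clinear_onD[OF nonneg_opD(2)[OF R(1)]]
  have "inj R"
  proof (rule injI)
    fix x y assume "R x = R y"
    then have "(norm (x - y))\<^sup>2 - inner (Z (x - y)) (x - y) / 2 = 0"
      unfolding normR[symmetric] by (simp add: Rlin)
    with Z_le[of "x - y"] have "(norm (x - y))\<^sup>2 \<le> 0" by linarith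
    then show "x = y" by simp
  qed
  \<comment> \<open>Already R R = I - Z/2 is onto, by the resolvent lemma for the contraction
    \<open>Z\<close> at z = 1/2.\<close>
  moreover have "surj R"
  proof (rule surjI)
    fix b
    have "\<exists>x. x - (1/2) *\<^sub>C Z x = b"
      using ex1_resolvent[OF nonneg_opD(2)[OF Z] nonneg_op_norm_le[OF Z Z_le], of "1/2" b] by auto
    moreover have "(1/2) *\<^sub>C Z x = (1/2) *\<^sub>R Z x" for x using scaleC_of_real[of "1/2" "Z x"] by simp
    ultimately have "\<exists>x. R (R x) = b" by (simp add: RR)
    then show "R (R (SOME x. R (R x) = b)) = b" by (rule someI_ex)
  qed
  ultimately have bij: "bij R" by (simp add: bij_def)
  have inv[simp]: "inv R (R x) = x" "R (inv R y) = y" for x y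
    using bij by (simp_all add: bij_is_inj bij_is_surj surj_f_inv_f)
  have inv_lin: "clinear_on UNIV UNIV (inv R)"
    unfolding clinear_on_def by (auto simp: Rlin intro: injD[OF bij_is_inj[OF bij]])
  have pass': "passive_system UNIV (R \<circ> A \<circ> inv R) (R \<circ> B) (C \<circ> inv R) D"
    unfolding passive_system_def
  proof (intro conjI ballI allI)
    fix g u
    define h where "h = inv R g"
    have g: "g = R h" by (simp add: h_def)
    \<comment> \<open>\<open>dis\<close> allows subtracting all of \<open>inner (Z h) h\<close> on
      the right, while the new norm removes only half; on the left the new norm only
      decreases.\<close>
    have "(norm (R (A h + B u)))\<^sup>2 + (norm (C h + D u))\<^sup>2 \<le> (norm (R h))\<^sup>2 + (norm u)\<^sup>2"
      using dis[of h u] nonneg_opD(4)[OF Z, of "A h + B u"] nonneg_opD(4)[OF Z, of h]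
      unfolding normR by linarith
    then show "norm (block_op (R \<circ> A \<circ> inv R) (R \<circ> B) (C \<circ> inv R) D (g, u)) \<le> norm (g, u)"
      by (simp add: block_op_def g norm_Pair Rlin)
  qed (use lin_simps Rlin clinear_onD[OF inv_lin] lins in
      \<open>auto simp: clinear_on_def complex_vector.subspace_UNIV\<close>)
  have pow: "((R \<circ> A \<circ> inv R) ^^ k) ((R \<circ> B) w) = R ((A ^^ k) (B w))" for k w
    by (induction k) simp_all
  define x where "x = (A ^^ n) (B v)"
  \<comment> \<open>A single input at index \<open>n\<close> isolates the reachable state
    \<open>x\<close> in the sums compared by optimality.\<close>
  define u where "u k = (if k = n then v else 0)" for k
  have A0: "(A ^^ k) 0 = 0" for k by (induction k) (simp_all add: lin_simps)
  have "(A ^^ k) (B (u k)) = (if k = n then x else 0)" for k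
    by (simp add: u_def x_def lin_simps A0)
  then have sum_u: "(\<Sum>k\<le>n. (A ^^ k) (B (u k))) = x" by simp
  have "norm (\<Sum>k\<le>n. (A ^^ k) (B (u k))) \<le>
      norm (\<Sum>k\<le>n. ((R \<circ> A \<circ> inv R) ^^ k) ((R \<circ> B) (u k)))"
    by (rule optimal_systemD[OF opt pass' realizes_conjugate[OF pass real nonneg_opD(2)[OF R(1)] bij]])
  also have "(\<Sum>k\<le>n. ((R \<circ> A \<circ> inv R) ^^ k) ((R \<circ> B) (u k))) = R x"
    unfolding pow sum_u[symmetric]
    by (simp only: linear_sum[OF bounded_linear.linear[OF nonneg_opD(1)[OF R(1)]]])
  finally have "(norm x)\<^sup>2 \<le> (norm (R x))\<^sup>2" unfolding sum_u by (intro power_mono) auto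
  then have "inner (Z x) x \<le> 0" unfolding normR by simp
  then show ?thesis unfolding x_def by (rule nonneg_op_apply_eq_0[OF Z])
qed

section \<open>Compression of competitors to the state space, and density of reachable
  states\<close>

theorem corollary7p4:
  fixes \<Theta> :: "complex \<Rightarrow> 'm::separable_hilbert_space \<Rightarrow> 'n::separable_hilbert_space"
    and A :: "'h::separable_hilbert_space \<Rightarrow> 'h" and B :: "'m \<Rightarrow> 'h"
    and C :: "'h \<Rightarrow> 'n" and D :: "'m \<Rightarrow> 'n" and T :: "'h \<times> 'm \<Rightarrow> 'h \<times> 'n"
  assumes "schur_class \<Theta>"
    and "passive_system UNIV A B C D" and "realizes UNIV A B C D \<Theta>"
    and "minimal_system A B C"
    and "optimal_system \<Theta> A B"
    and "T = block_op A B C D"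
  shows "shorted_op (defect_op T \<circ> defect_op T) (UNIV \<times> {0}) = (\<lambda>_. 0)"
proof -
  note pass = assms(2) and T = assms(6)
  have lins: "clinear_on UNIV UNIV A" "clinear_on UNIV UNIV B" "clinear_on UNIV UNIV C"
    "clinear_on UNIV UNIV D"
    using pass by (auto simp: passive_system_def)
  have Tlin: "clinear_on UNIV UNIV T"
    unfolding clinear_on_def T block_op_def
    by (auto simp: lins[THEN clinear_onD(1)] lins[THEN clinear_onD(2)] scaleC_prod_def
        scaleC_add_right)
  have Tcontr: "norm (T x) \<le> norm x" for x
    using pass by (cases x) (auto simp: passive_system_def T)
  note defect = defect_op_square[OF Tlin Tcontr]
  \<comment> \<open>Every operator competing for the maximum vanishes, so the maximum is taken over
    a singleton.\<close>
  have zero: "Z = (\<lambda>_. 0)"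
    if Z: "nonneg_op Z" "op_le Z (defect_op T \<circ> defect_op T)" "range Z \<subseteq> UNIV \<times> {0}" for Z
  proof -
    note Zlin = clinear_onD[OF nonneg_opD(2)[OF Z(1)]]
    have snd0: "snd (Z x) = 0" for x
      using subsetD[OF Z(3) rangeI[of Z x]] by (simp add: mem_Times_iff)
    \<comment> \<open>The range condition makes the form of \<open>Z\<close> vanish at (0, u), hence
      \<open>Z\<close> kills inputs and is determined by its compression \<open>Z0\<close>.\<close>
    have "Z (0, u) = 0" for u
      by (rule nonneg_op_apply_eq_0[OF Z(1)]) (simp add: inner_prod_def snd0)
    then have Z_eq: "Z (h, u) = Z (h, 0)" for h u using Zlin(1)[of "(h, 0)" "(0, u)"] by simp
    define Z0 where "Z0 h = fst (Z (h, 0))" for h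
    have Z_Z0: "Z (h, u) = (Z0 h, 0)" for h u
      unfolding Z_eq[of h u] Z0_def by (simp add: prod_eq_iff snd0)
    have nn0: "nonneg_op Z0"
      unfolding nonneg_op_iff
    proof (intro conjI allI)
      show "bounded_linear Z0"
        unfolding Z0_def
        by (intro bounded_linear_compose[OF bounded_linear_fst]
            bounded_linear_compose[OF nonneg_opD(1)[OF Z(1)]] bounded_linear_Pair
            bounded_linear_ident bounded_linear_zero)
      show "clinear_on UNIV UNIV Z0"
        unfolding clinear_on_def
      proof (intro conjI ballI allI)
        fix x y c
        show "Z0 (x + y) = Z0 x + Z0 y" using Zlin(1)[of "(x, 0)" "(y, 0)"] by (simp add: Z0_def)
        show "Z0 (c *\<^sub>C x) = c *\<^sub>C Z0 x"
          using Zlin(2)[of c "(x, 0)"] by (simp add: Z0_def scaleC_prod_def)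
      qed simp
      show "inner (Z0 x) y = inner x (Z0 y)" for x y
        using nonneg_opD(3)[OF Z(1), of "(x, 0)" "(y, 0)"] by (simp add: Z_Z0 inner_prod_def)
      show "0 \<le> inner (Z0 x) x" for x
        using nonneg_opD(4)[OF Z(1), of "(x, 0)"] by (simp add: Z_Z0 inner_prod_def)
    qed
    \<comment> \<open>This is the inequality of forms between \<open>Z\<close> and the squared
      defect, read at (h, u).\<close>
    have dis: "(norm (A h + B u))\<^sup>2 + (norm (C h + D u))\<^sup>2 + inner (Z0 h) h
        \<le> (norm h)\<^sup>2 + (norm u)\<^sup>2" for h u
      using op_leD[OF Z(2), of "(h, u)"] unfolding defect(2)
      by (simp add: Z_Z0 inner_prod_def T block_op_def norm_Pair)
    \<comment> \<open>The kernel is a closed complex subspace containing all reachable states, so by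
      minimality it is the whole space.\<close>
    let ?N = "{x. Z0 x = 0}"
    have "csubspace ?N"
      unfolding complex_vector.subspace_def using clinear_onD[OF nonneg_opD(2)[OF nn0]] by simp
    moreover have "(\<Union>n. range (A ^^ n \<circ> B)) \<subseteq> ?N"
      using optimal_system_dissipation_eq_0[OF pass assms(3,5) nn0 dis] by auto
    ultimately have "cspan (\<Union>n. range (A ^^ n \<circ> B)) \<subseteq> ?N"
      by (intro complex_vector.span_minimal)
    moreover have "closed ?N"
      using closed_Collect_eq[of Z0 "\<lambda>_. 0"]
        linear_continuous_on[OF nonneg_opD(1)[OF nn0]] by simp
    ultimately have "closure (cspan (\<Union>n. range (A ^^ n \<circ> B))) \<subseteq> ?N"
      by (rule closure_minimal)
    then have "Z0 h = 0" for h using assms(4) by (auto simp: minimal_system_def)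
    then show ?thesis by (auto simp: Z_Z0 zero_prod_def)
  qed
  have zero_le: "op_le (\<lambda>_. 0) (defect_op T \<circ> defect_op T)"
    using defect(1) by (simp add: op_le_def comp_def)
  have refl: "op_le (\<lambda>_. 0) (\<lambda>_ :: 'h \<times> 'm. 0 :: 'h \<times> 'm)"
    by (simp add: op_le_def nonneg_op_zero)
  let ?Z = "{Z. nonneg_op Z \<and> op_le Z (defect_op T \<circ> defect_op T) \<and> range Z \<subseteq> UNIV \<times> {0}}"
  have "range (\<lambda>_ :: 'h \<times> 'm. 0 :: 'h \<times> 'm) \<subseteq> UNIV \<times> {0}" by (auto simp: mem_Times_iff)
  then have "?Z = {\<lambda>_. 0}" using zero zero_le nonneg_op_zero by blast
  then have "shorted_op (defect_op T \<circ> defect_op T) (UNIV \<times> {0})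
      = (THE Z. Z \<in> {\<lambda>_. 0} \<and> (\<forall>W\<in>{\<lambda>_. 0}. op_le W Z))"
    unfolding shorted_op_def Let_def by (rule arg_cong)
  also have "\<dots> = (\<lambda>_. 0)" by (rule the_equality) (use refl in blast)+
  finally show ?thesis .
qed

end
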